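(* Vertex Cover Discovery can be solved in $O(n^4)$ time on split graphs, where $n$ is the number of vertices of the input graph.
   Context: A split graph is a graph whose vertex set can be partitioned into a clique and an independent set. A configuration is a vertex subset of $G$; two configurations $S,S'$ are adjacent if $S'=(S\setminus\{x\})\cup\{y\}$ for some $x\in S$, $y\in V(G)\setminus S$ with $xy\in E(G)$; reachability in $\ell$ steps means a sequence of $\ell$ such moves. Vertex Cover Discovery: given a graph $G$, an initial configuration $S$, and an integer $b\ge0$, decide whether some vertex cover of $G$ is reachable from $S$ in at most $b$ steps. *)

theory Defs
  imports Complex_Main "HOL-Library.Landau_Symbols"
begin

section \<open>Graphs, configurations and the discovery problem\<close>

definition simple_graph :: "'a set \<Rightarrow> 'a set set \<Rightarrow> bool" where
  "simple_graph V E \<longleftrightarrow> finite V \<and> E \<subseteq> {{u, v} | u v. u \<in> V \<and> v \<in> V \<and> u \<noteq> v}"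

definition clique :: "'a set set \<Rightarrow> 'a set \<Rightarrow> bool" where
  "clique E K \<longleftrightarrow> (\<forall>u\<in>K. \<forall>v\<in>K. u \<noteq> v \<longrightarrow> {u, v} \<in> E)"

definition independent_set :: "'a set set \<Rightarrow> 'a set \<Rightarrow> bool" where
  "independent_set E I \<longleftrightarrow> (\<forall>u\<in>I. \<forall>v\<in>I. {u, v} \<notin> E)"

definition split_graph :: "'a set \<Rightarrow> 'a set set \<Rightarrow> bool" where
  "split_graph V E \<longleftrightarrow> simple_graph V E \<and>
     (\<exists>K I. K \<union> I = V \<and> K \<inter> I = {} \<and> clique E K \<and> independent_set E I)"

definition vertex_cover :: "'a set \<Rightarrow> 'a set set \<Rightarrow> 'a set \<Rightarrow> bool" where
  "vertex_cover V E C \<longleftrightarrow> C \<subseteq> V \<and> (\<forall>e\<in>E. e \<inter> C \<noteq> {})"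

definition slide :: "'a set \<Rightarrow> 'a set set \<Rightarrow> 'a set \<Rightarrow> 'a set \<Rightarrow> bool" where
  "slide V E S S' \<longleftrightarrow> (\<exists>x\<in>S. \<exists>y\<in>V - S. {x, y} \<in> E \<and> S' = (S - {x}) \<union> {y})"

definition vertex_cover_discovery :: "'a set \<Rightarrow> 'a set set \<Rightarrow> 'a set \<Rightarrow> nat \<Rightarrow> bool" where
  "vertex_cover_discovery V E S b \<longleftrightarrow>
     (\<exists>l\<le>b. \<exists>C. (slide V E ^^ l) S C \<and> vertex_cover V E C)"


section \<open>A word RAM with structured programs\<close>

text \<open>
  The machine has registers and finitely many (as many as the program mentions) arrays, all
  indexed by natural numbers, whose cells hold words of \<open>w\<close> bits, i.e. numbers below
  \<open>2 ^ w\<close>. Every arithmetic, comparison and memory operation takes unit time.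
  A program has no execution past an operation whose result does not fit into a word, so unit
  cost cannot be exploited by computing with huge numbers. Keeping several arrays instead of one
  memory changes running times by at most a constant factor (interleave the arrays).
\<close>

record state =
  regs :: "nat \<Rightarrow> nat"
  arrs :: "nat \<Rightarrow> nat \<Rightarrow> nat"

datatype aexp =
    Const nat
  | Reg nat
  | Read nat aexp
  | Add aexp aexp
  | Sub aexp aexp
  | Mul aexp aexp

datatype bexp =
    Eq aexp aexp
  | Less aexp aexp
  | BNot bexp
  | BAnd bexp bexp

datatype com =
    Skip
  | Assign nat aexp
  | Write nat aexp aexp
  | Seq com com
  | Cond bexp com com
  | While bexp com

primrec aval :: "state \<Rightarrow> aexp \<Rightarrow> nat" where
  "aval s (Const m) = m"
| "aval s (Reg x) = regs s x"
| "aval s (Read a e) = arrs s a (aval s e)"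
| "aval s (Add e f) = aval s e + aval s f"
| "aval s (Sub e f) = aval s e - aval s f"  \<comment> \<open>truncated at \<open>0\<close>\<close>
| "aval s (Mul e f) = aval s e * aval s f"

primrec bval :: "state \<Rightarrow> bexp \<Rightarrow> bool" where
  "bval s (Eq e f) \<longleftrightarrow> aval s e = aval s f"
| "bval s (Less e f) \<longleftrightarrow> aval s e < aval s f"
| "bval s (BNot p) \<longleftrightarrow> \<not> bval s p"
| "bval s (BAnd p q) \<longleftrightarrow> bval s p \<and> bval s q"

text \<open>All intermediate results, array indices included, are \<open>w\<close>-bit words.\<close>

primrec afits :: "nat \<Rightarrow> state \<Rightarrow> aexp \<Rightarrow> bool" where
  "afits w s (Const m) \<longleftrightarrow> m < 2 ^ w"
| "afits w s (Reg x) \<longleftrightarrow> regs s x < 2 ^ w"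
| "afits w s (Read a e) \<longleftrightarrow> afits w s e \<and> arrs s a (aval s e) < 2 ^ w"
| "afits w s (Add e f) \<longleftrightarrow> afits w s e \<and> afits w s f \<and> aval s e + aval s f < 2 ^ w"
| "afits w s (Sub e f) \<longleftrightarrow> afits w s e \<and> afits w s f"
| "afits w s (Mul e f) \<longleftrightarrow> afits w s e \<and> afits w s f \<and> aval s e * aval s f < 2 ^ w"

primrec bfits :: "nat \<Rightarrow> state \<Rightarrow> bexp \<Rightarrow> bool" where
  "bfits w s (Eq e f) \<longleftrightarrow> afits w s e \<and> afits w s f"
| "bfits w s (Less e f) \<longleftrightarrow> afits w s e \<and> afits w s f"
| "bfits w s (BNot p) \<longleftrightarrow> bfits w s p"
| "bfits w s (BAnd p q) \<longleftrightarrow> bfits w s p \<and> bfits w s q"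

primrec acost :: "aexp \<Rightarrow> nat" where
  "acost (Const m) = 1"
| "acost (Reg x) = 1"
| "acost (Read a e) = 1 + acost e"
| "acost (Add e f) = 1 + acost e + acost f"
| "acost (Sub e f) = 1 + acost e + acost f"
| "acost (Mul e f) = 1 + acost e + acost f"

primrec bcost :: "bexp \<Rightarrow> nat" where
  "bcost (Eq e f) = 1 + acost e + acost f"
| "bcost (Less e f) = 1 + acost e + acost f"
| "bcost (BNot p) = 1 + bcost p"
| "bcost (BAnd p q) = 1 + bcost p + bcost q"

text \<open>
  \<open>exec w c s t s'\<close>: with word length \<open>w\<close>, the program \<open>c\<close> started in state \<open>s\<close>
  halts in state \<open>s'\<close> after exactly \<open>t\<close> unit-time operations.
\<close>

inductive exec :: "nat \<Rightarrow> com \<Rightarrow> state \<Rightarrow> nat \<Rightarrow> state \<Rightarrow> bool" for w :: nat where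
  Skip: "exec w Skip s 1 s"
| Assign: "afits w s e \<Longrightarrow>
    exec w (Assign x e) s (1 + acost e) (s\<lparr>regs := (regs s)(x := aval s e)\<rparr>)"
| Write: "afits w s i \<Longrightarrow> afits w s e \<Longrightarrow>
    exec w (Write a i e) s (1 + acost i + acost e)
      (s\<lparr>arrs := (arrs s)(a := (arrs s a)(aval s i := aval s e))\<rparr>)"
| Seq: "exec w c s t s' \<Longrightarrow> exec w d s' t' s'' \<Longrightarrow> exec w (Seq c d) s (t + t') s''"
| CondTrue: "bfits w s p \<Longrightarrow> bval s p \<Longrightarrow> exec w c s t s' \<Longrightarrow>
    exec w (Cond p c d) s (1 + bcost p + t) s'"
| CondFalse: "bfits w s p \<Longrightarrow> \<not> bval s p \<Longrightarrow> exec w d s t s' \<Longrightarrow>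
    exec w (Cond p c d) s (1 + bcost p + t) s'"
| WhileFalse: "bfits w s p \<Longrightarrow> \<not> bval s p \<Longrightarrow>
    exec w (While p c) s (1 + bcost p) s"
| WhileTrue: "bfits w s p \<Longrightarrow> bval s p \<Longrightarrow> exec w c s t s' \<Longrightarrow>
    exec w (While p c) s' t' s'' \<Longrightarrow>
    exec w (While p c) s (1 + bcost p + t + t') s''"

lemma exec_deterministic:
  assumes "exec w c s t s'" and "exec w c s u r"
  shows "t = u \<and> s' = r"
  using assms
proof (induction arbitrary: u r rule: exec.induct)
  case (Skip s)
  then show ?case by cases simp
next
  case (Assign s e x)
  from Assign.prems show ?case by cases simp
next
  case (Write s i e a)
  from Write.prems show ?case by cases simp
next
  case (Seq c s t s' d t' s'')
  from Seq.prems obtain t1 s1 t2 where "exec w c s t1 s1" "exec w d s1 t2 r" "u = t1 + t2"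
    by cases blast
  with Seq.IH show ?case by blast
next
  case (CondTrue s p c t s' d)
  from CondTrue.prems CondTrue.hyps obtain t1 where "exec w c s t1 r" "u = 1 + bcost p + t1"
    by cases blast+
  with CondTrue.IH show ?case by blast
next
  case (CondFalse s p d t s' c)
  from CondFalse.prems CondFalse.hyps obtain t1 where "exec w d s t1 r" "u = 1 + bcost p + t1"
    by cases blast+
  with CondFalse.IH show ?case by blast
next
  case (WhileFalse s p c)
  from WhileFalse.prems WhileFalse.hyps show ?case by cases blast+
next
  case (WhileTrue s p c t s' t' s'')
  from WhileTrue.prems WhileTrue.hyps obtain t1 s1 t2
    where "exec w c s t1 s1" "exec w (While p c) s1 t2 r" "u = 1 + bcost p + t1 + t2"
    by cases blast+
  with WhileTrue.IH show ?case by blast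
qed

text \<open>Register \<open>0\<close> holds the answer: \<open>1\<close> for yes, \<open>0\<close> for no.\<close>

definition decides_within :: "nat \<Rightarrow> com \<Rightarrow> state \<Rightarrow> nat \<Rightarrow> bool \<Rightarrow> bool" where
  "decides_within w P s T Q \<longleftrightarrow> (\<exists>t\<le>T. \<exists>s'. exec w P s t s' \<and> regs s' 0 = of_bool Q)"

text \<open>
  Input encoding for an instance on the vertex set \<open>{..<n}\<close>: register \<open>0\<close> holds \<open>n\<close>,
  register \<open>1\<close> holds \<open>b\<close>, array \<open>0\<close> holds the adjacency matrix of the graph in row-major
  order, array \<open>1\<close> the characteristic vector of \<open>S\<close>, and everything else is \<open>0\<close>.
  In particular, the program is not given a partition into a clique and an independent set.
\<close>

definition encode_instance :: "nat \<Rightarrow> nat set set \<Rightarrow> nat set \<Rightarrow> nat \<Rightarrow> state" where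
  "encode_instance n E S b =
    \<lparr>regs = (\<lambda>_. 0)(0 := n, 1 := b),
     arrs = (\<lambda>_ _. 0)
       (0 := (\<lambda>m. of_bool (m < n * n \<and> {m div n, m mod n} \<in> E)),
        1 := (\<lambda>i. of_bool (i < n \<and> i \<in> S)))\<rparr>"

end

theory Submission
  imports Defs
begin

text \<open>
  A vertex cover of a split graph with clique \<open>K\<close> and independent set \<open>I\<close> contains \<open>K\<close>, or it contains
  \<open>K - {v}\<close> and the neighbours of \<open>v\<close> for some \<open>v \<in> K\<close>. Fix one of these \<open>n + 1\<close> required sets. A hole,
  i.e. a required vertex without a token, is filled by a token that is not on a required vertex, and
  as distances are at most \<open>3\<close>, this costs \<open>2\<close> for holes in \<open>K\<close> and \<open>3\<close> for holes in \<open>I\<close>, or one step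
  less for certain pairs of token and hole. So the minimal number of steps is determined by the size
  of a maximum matching in the bipartite graph of the cheaper pairs. That fewer steps do not suffice
  follows from a minimum cover of this bipartite graph (Koenig): it yields a function on the vertices
  that changes by at most \<open>1\<close> along edges, and its sum over the tokens bounds the number of slides.
  Each of the \<open>n + 1\<close> matchings takes \<open>O(n)\<close> breadth-first searches of \<open>O(n\<^sup>2)\<close> steps. The partition
  \<open>K\<close>, \<open>I\<close> is found by trying all thresholds for the vertex degree.
\<close>

section \<open>Token sliding in split graphs\<close>

text \<open>Unweighted matching suffices because a pair of token and hole saves \<open>0\<close> or
  \<open>1\<close> steps, with one exception: a token on the missed vertex \<open>v\<close> is
  adjacent to every hole and saves \<open>2\<close> at a hole in \<open>I\<close>. Weights are
  avoided by reserving this token for such a hole whenever there is one and booking its second saved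
  step separately. Tokens on isolated vertices can never move, so the supply of tokens is a
  condition of its own besides the cost inequality. The lower bound is weak duality for transporting
  tokens in the graph metric: it only compares sums over vertex sets and never has to trace which
  token ends where. On the machine side, every loop, even the walk back along an augmenting path, is
  a \<open>for_loop\<close> with the same bound \<open>N\<close>. The running time is then a
  polynomial in \<open>N\<close> whose degree is the nesting depth of the program text, and only
  correctness remains to be shown for the individual routines.\<close>

abbreviation adj :: "'a set set \<Rightarrow> 'a \<Rightarrow> 'a \<Rightarrow> bool" where
  "adj E x y \<equiv> {x, y} \<in> E"

lemma adj_commute: "adj E x y \<longleftrightarrow> adj E y x"
  by (simp add: insert_commute)

lemma simple_graph_adjD:
  assumes "simple_graph V E" "adj E x y"
  shows "x \<in> V" "y \<in> V" "x \<noteq> y"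
proof -
  from assms obtain u v where "{x, y} = {u, v}" "u \<in> V" "v \<in> V" "u \<noteq> v"
    unfolding simple_graph_def by blast
  then show "x \<in> V" "y \<in> V" "x \<noteq> y" by (auto simp: doubleton_eq_iff)
qed

lemma walk_intros:
  "R x y \<Longrightarrow> (R ^^ 1) x y"
  "R x y \<Longrightarrow> R y z \<Longrightarrow> (R ^^ 2) x z"
  "R x y \<Longrightarrow> R y z \<Longrightarrow> R z u \<Longrightarrow> (R ^^ 3) x u"
  by (auto simp: eval_nat_numeral)

subsection \<open>Sliding tokens along walks\<close>

text \<open>Tokens are indistinguishable, so a token in the way takes over the rest of the walk.\<close>

lemma slide_along_walk:
  assumes "(adj E ^^ d) t h" "t \<in> S" "h \<notin> S" "simple_graph V E"
  shows "\<exists>l\<le>d. (slide V E ^^ l) S (insert h (S - {t}))"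
  using assms(1-3)
proof (induction d arbitrary: t S)
  case 0
  then show ?case by simp
next
  case (Suc d)
  then obtain y where ty: "adj E t y" and yh: "(adj E ^^ d) y h"
    by (meson relpowp_Suc_D2)
  note y = simple_graph_adjD[OF assms(4) ty]
  show ?case
  proof (cases "y \<in> S")
    case False
    let ?S = "insert y (S - {t})"
    have s: "slide V E S ?S"
      unfolding slide_def using False Suc.prems y ty by blast
    show ?thesis
    \<comment> \<open>A walk may meet \<open>h\<close> before its end; this is why at most
      \<open>d\<close> slides are claimed, not exactly \<open>d\<close>.\<close>
    proof (cases "y = h")
      case True
      with s show ?thesis by (intro exI[of _ 1]) auto
    next
      case neq: False
      from Suc.IH[OF yh, of ?S] neq Suc.prems obtain l
        where l: "l \<le> d" "(slide V E ^^ l) ?S (insert h (?S - {y}))" by auto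
      moreover have "insert h (?S - {y}) = insert h (S - {t})" using False by auto
      ultimately show ?thesis using relpowp_Suc_I2[of "slide V E", OF s, of l]
        by (metis Suc_le_mono)
    qed
  next
    case True
    \<comment> \<open>The blocking token leaves first, so \<open>y\<close> is free when
      \<open>t\<close> slides onto it.\<close>
    from Suc.IH[OF yh True Suc.prems(3)] obtain l
      where l: "l \<le> d" "(slide V E ^^ l) S (insert h (S - {y}))" by blast
    have "y \<noteq> h" using True Suc.prems by auto
    then have "slide V E (insert h (S - {y})) (insert y (insert h (S - {y}) - {t}))"
      unfolding slide_def using Suc.prems y ty by blast
    moreover have "insert y (insert h (S - {y}) - {t}) = insert h (S - {t})"
      using True Suc.prems y by auto
    ultimately show ?thesis using l
      by (intro exI[of _ "Suc l"]) auto
  qed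
qed

text \<open>Whatever moves in between, the net effect of \<open>slide_along_walk\<close> is to
  exchange one token with one hole. The other assigned pairs stay intact, and the lengths add
  up.\<close>

lemma slide_to_holes:
  assumes "finite H" "H \<inter> S = {}" "inj_on f H" "f ` H \<subseteq> S" "simple_graph V E"
    and "\<And>h. h \<in> H \<Longrightarrow> \<exists>d\<le>L h. (adj E ^^ d) (f h) h"
  shows "\<exists>l\<le>sum L H. (slide V E ^^ l) S ((S - f ` H) \<union> H)"
  using assms(1-4,6)
proof (induction H arbitrary: S rule: finite_induct)
  case empty
  then show ?case by (auto intro!: exI[of _ 0])
next
  case (insert h H)
  from insert.prems(4)[of h] obtain d where d: "d \<le> L h" "(adj E ^^ d) (f h) h" by auto
  let ?S = "insert h (S - {f h})"
  from slide_along_walk[OF d(2) _ _ assms(5), of S] insert.prems obtain l1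
    where l1: "l1 \<le> d" "(slide V E ^^ l1) S ?S" by auto
  have "\<exists>l\<le>sum L H. (slide V E ^^ l) ?S ((?S - f ` H) \<union> H)"
  proof (rule insert.IH)
    have "f h \<notin> f ` H" using insert.prems(2) insert.hyps by simp
    then show "f ` H \<subseteq> insert h (S - {f h})" using insert.prems(3) by blast
  qed (use insert.prems insert.hyps in auto)
  then obtain l2 where l2: "l2 \<le> sum L H" "(slide V E ^^ l2) ?S ((?S - f ` H) \<union> H)" by blast
  have "(?S - f ` H) \<union> H = (S - f ` insert h H) \<union> insert h H"
    using insert.prems insert.hyps by auto
  with l1 l2 have "(slide V E ^^ (l1 + l2)) S ((S - f ` insert h H) \<union> insert h H)"
    by (auto simp: relpowp_add)
  moreover have "l1 + l2 \<le> sum L (insert h H)" using l1 l2 d insert.hyps by simp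
  ultimately show ?case by blast
qed

subsection \<open>Invariants of sliding\<close>

lemma slides_subset_card:
  assumes "(slide V E ^^ l) S C" "S \<subseteq> V" "finite V"
  shows "C \<subseteq> V \<and> card C = card S"
  using assms(1)
proof (induction l arbitrary: C)
  case 0
  with assms show ?case by simp
next
  case (Suc l)
  from Suc.prems obtain D where D: "(slide V E ^^ l) S D" "slide V E D C" by auto
  with Suc.IH have IH: "D \<subseteq> V" "card D = card S" by auto
  from D(2) obtain x y where xy: "x \<in> D" "y \<in> V - D" "C = insert y (D - {x})"
    unfolding slide_def by auto
  have "finite D" using IH assms(3) finite_subset by blast
  with xy IH show ?case by (auto simp: card_insert_if card_Suc_Diff1 simp del: card_Diff_insert)
qed

lemma slides_isolated:
  assumes "(slide V E ^^ l) S C" "\<And>y. \<not> adj E x y"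
  shows "x \<in> C \<longleftrightarrow> x \<in> S"
  using assms(1)
proof (induction l arbitrary: C)
  case (Suc l)
  from Suc.prems obtain D where D: "(slide V E ^^ l) S D" "slide V E D C" by auto
  have "x \<in> C \<longleftrightarrow> x \<in> D" using D(2) assms(2) by (auto simp: slide_def insert_commute)
  with Suc.IH D show ?case by blast
qed simp

text \<open>One slide replaces the summand \<open>p x\<close> by \<open>p y\<close>. Since adjacency
  is symmetric, the condition says that \<open>p\<close> is 1-Lipschitz, and every such
  \<open>p\<close> certifies a lower bound on the number of slides.\<close>

lemma slides_potential:
  fixes p :: "'a \<Rightarrow> int"
  assumes "(slide V E ^^ l) S C" "S \<subseteq> V" "finite V"
    and "\<And>x y. adj E x y \<Longrightarrow> p y \<le> p x + 1"
  shows "sum p C \<le> sum p S + int l"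
  using assms(1)
proof (induction l arbitrary: C)
  case (Suc l)
  from Suc.prems obtain D where D: "(slide V E ^^ l) S D" "slide V E D C" by auto
  then obtain x y where xy: "x \<in> D" "y \<in> V - D" "C = insert y (D - {x})" "adj E x y"
    unfolding slide_def by auto
  have "finite D" using slides_subset_card[OF D(1) assms(2,3)] assms(3) finite_subset by blast
  then have "sum p C = p y + (sum p D - p x)" using xy by (simp add: sum_diff1)
  with Suc.IH[OF D(1)] assms(4)[OF xy(4)] show ?case by simp
qed simp

subsection \<open>The matching instance belonging to a cover\<close>

text \<open>
  \<open>v \<in> K\<close> is the clique vertex missed by a cover; a \<open>v\<close> outside the graph stands for the covers
  that contain all of \<open>K\<close>.
\<close>

locale split_instance =
  fixes V :: "'a set" and E K I S v
  assumes graph: "simple_graph V E"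
    and part: "K \<union> I = V" "K \<inter> I = {}"
    and clique: "clique E K" and indep: "independent_set E I"
    and S: "S \<subseteq> V"
    and v_cases: "v \<in> K \<or> v \<notin> V"
begin

definition "required = (K - {v}) \<union> {x \<in> I. adj E v x}"
definition "clique_holes = K - {v} - S"
definition "indep_holes = {x \<in> I. adj E v x} - S"
text \<open>These are the tokens off \<open>required\<close> that are able to move. An isolated
  \<open>v\<close> in \<open>K\<close> needs no exception: then \<open>K = {v}\<close>, nothing is
  required and there are no holes.\<close>

definition "tokens = {t \<in> S. t = v \<or> t \<in> I \<and> \<not> adj E v t \<and> (\<exists>x. adj E t x)}"

text \<open>
  Generically a hole costs \<open>2\<close> in \<open>K\<close> and \<open>3\<close> in \<open>I\<close>; \<open>saves t h\<close> says that the token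
  \<open>t\<close> does it with one step less. A token on \<open>v\<close> fills a hole in \<open>I\<close> with two
  steps less; one of these is accounted for by \<open>bonus\<close>, since without loss of generality
  this token is used for a hole in \<open>I\<close> if there is any.
\<close>

definition "saves t h \<longleftrightarrow> t \<in> tokens \<and> h \<in> clique_holes \<union> indep_holes \<and>
  (if t = v then indep_holes = {} \<or> h \<in> indep_holes
   else if h \<in> K then adj E t h else \<exists>x. adj E t x \<and> adj E h x)"

definition bonus :: nat where "bonus = of_bool (v \<in> S \<and> indep_holes \<noteq> {})"

lemmas defs = required_def clique_holes_def indep_holes_def tokens_def

lemma finite_V: "finite V" using graph by (simp add: simple_graph_def)

lemma finite_parts [simp]: "finite K" "finite I" "finite S"
  using finite_V part S by (auto intro: finite_subset)

lemma finite_defs [simp]: "finite required" "finite clique_holes" "finite indep_holes" "finite tokens"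
  by (auto simp: defs)

lemma holes_eq: "clique_holes \<union> indep_holes = required - S"
  by (auto simp: defs)

lemma disjoint_holes: "clique_holes \<inter> indep_holes = {}"
  using part by (auto simp: defs)

lemma adjD: "adj E x y \<Longrightarrow> x \<in> V \<and> y \<in> V \<and> x \<noteq> y"
  using simple_graph_adjD[OF graph] by blast

lemma adj_indepD: "adj E x y \<Longrightarrow> x \<in> I \<Longrightarrow> y \<in> K"
  using adjD[of x y] part indep by (auto simp: independent_set_def)

lemma adj_cliqueI: "x \<in> K \<Longrightarrow> y \<in> K \<Longrightarrow> x \<noteq> y \<Longrightarrow> adj E x y"
  using clique by (auto simp: clique_def)

text \<open>An edge avoiding \<open>K - {v}\<close> has both ends in \<open>I\<close> or
  \<open>v\<close>, hence joins \<open>v\<close> to a neighbour in \<open>I\<close>.\<close>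

lemma vertex_cover_required:
  assumes "required \<subseteq> C" "C \<subseteq> V"
  shows "vertex_cover V E C"
  unfolding vertex_cover_def
proof (intro conjI ballI assms(2))
  fix e assume e: "e \<in> E"
  with graph obtain x y where xy: "e = {x, y}" unfolding simple_graph_def by blast
  with e have "adj E x y" "adj E y x" by (auto simp: insert_commute)
  then have "x \<in> required \<or> y \<in> required"
    using adjD[of x y] adj_indepD[of x y] adj_indepD[of y x] part
    by (cases "x = v"; cases "y = v") (auto simp: required_def)
  with assms xy show "e \<inter> C \<noteq> {}" by auto
qed

text \<open>A token on \<open>v\<close> is adjacent to every hole. Any other token \<open>t\<close>
  lies in \<open>I\<close> and has a neighbour \<open>x\<close> in \<open>K\<close>; it reaches a
  clique hole through \<open>x\<close>, and a hole \<open>h\<close> in \<open>I\<close> by the walk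
  \<open>t\<close>, \<open>x\<close>, \<open>v\<close>, \<open>h\<close> unless a common neighbour
  of \<open>t\<close> and \<open>h\<close> shortens it.\<close>

lemma walk_token:
  assumes t: "t \<in> tokens" and h: "h \<in> clique_holes \<union> indep_holes"
  shows "\<exists>d\<le>(if h \<in> K then 2 else 3) - of_bool (saves t h) - of_bool (t = v \<and> indep_holes \<noteq> {} \<and> h \<in> indep_holes).
    (adj E ^^ d) t h"
proof -
  have neq: "t \<noteq> h" using t h by (auto simp: defs)
  consider (v) "t = v" | (edge) "t \<noteq> v" "adj E t h" | (K) "t \<noteq> v" "\<not> adj E t h" "h \<in> K"
    | (common) "t \<noteq> v" "\<exists>x. adj E t x \<and> adj E x h" "h \<notin> K"
    | (I) "t \<noteq> v" "\<not> (\<exists>x. adj E t x \<and> adj E x h)" "h \<notin> K" "\<not> adj E t h" by blast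
  then show ?thesis
  proof cases
    case v
    then have "adj E t h" using t h neq v_cases S
      by (auto simp: defs intro: adj_cliqueI)
    then have "(adj E ^^ 1) t h" by (rule walk_intros)
    then show ?thesis using h part by (intro exI[of _ 1]) (auto simp: defs)
  next
    case edge
    then have "h \<in> K" using t adj_indepD by (auto simp: tokens_def)
    moreover have "(adj E ^^ 1) t h" using edge(2) by (rule walk_intros)
    ultimately show ?thesis using edge by (intro exI[of _ 1]) auto
  next
    case K
    from K t obtain x where x: "t \<in> I" "adj E t x" by (auto simp: tokens_def)
    with K have "adj E x h" using adj_indepD by (metis adj_cliqueI)
    with x have "(adj E ^^ 2) t h" by (blast intro: walk_intros)
    with K show ?thesis by (intro exI[of _ 2]) (auto simp: saves_def)
  next
    case common
    then have "(adj E ^^ 2) t h" by (blast intro: walk_intros)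
    with common show ?thesis by (intro exI[of _ 2]) (auto simp: saves_def)
  next
    case I
    from I t obtain x where x: "t \<in> I" "adj E t x" by (auto simp: tokens_def)
    from I h have h': "h \<in> I" "adj E v h" by (auto simp: defs)
    have "x \<in> K" using x adj_indepD by blast
    moreover have "v \<in> K" using h' adjD v_cases by blast
    moreover have "x \<noteq> v" using I x h' by blast
    ultimately have "adj E x v" by (blast intro: adj_cliqueI)
    with x h' have "(adj E ^^ 3) t h" by (blast intro: walk_intros)
    moreover have "\<not> saves t h" using I by (auto simp: saves_def insert_commute)
    ultimately show ?thesis using I by (intro exI[of _ 3]) auto
  qed
qed

text \<open>By cardinality the matching extends to an injective assignment of tokens to all holes.
  The added pairs pay the generic cost, the matched ones at least one step less.\<close>

lemma discovery_if_matching: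
  assumes D: "D \<subseteq> clique_holes \<union> indep_holes" "inj_on g D" "\<And>h. h \<in> D \<Longrightarrow> saves (g h) h"
    and enough: "card (clique_holes \<union> indep_holes) \<le> card tokens"
    and cost: "2 * card clique_holes + 3 * card indep_holes \<le> b + card D + bonus"
  shows "vertex_cover_discovery V E S b"
proof -
  let ?H = "clique_holes \<union> indep_holes"
  \<comment> \<open>If the bonus counts, \<open>v\<close> has to be in use. Giving \<open>v\<close>
    to any hole in \<open>I\<close>, matched or not, keeps the assignment injective and does not
    shrink its domain.\<close>
  have "\<exists>D' g'. D' \<subseteq> ?H \<and> inj_on g' D' \<and> (\<forall>h\<in>D'. saves (g' h) h) \<and> card D \<le> card D' \<and>
    (bonus = 1 \<longrightarrow> v \<in> g' ` D')"
  proof (cases "bonus = 1 \<and> v \<notin> g ` D")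
    case True
    then obtain h where h: "h \<in> indep_holes" "v \<in> S" by (auto simp: bonus_def of_bool_def split: if_splits)
    then have "saves v h" by (auto simp: saves_def tokens_def)
    moreover have "inj_on (g(h := v)) (insert h D)"
      using D(2) True by (auto simp: inj_on_def)
    moreover have "finite D" using D(1) by (rule finite_subset) simp
    ultimately show ?thesis using D h
      by (intro exI[of _ "insert h D"] exI[of _ "g(h := v)"]) (auto intro: card_mono)
  qed (use D in blast)
  then obtain D' g' where D': "D' \<subseteq> ?H" "inj_on g' D'" "\<And>h. h \<in> D' \<Longrightarrow> saves (g' h) h"
    "card D \<le> card D'" "bonus = 1 \<Longrightarrow> v \<in> g' ` D'" by blast
  have fin: "finite D'" using D'(1) by (rule finite_subset) simp
  have img: "g' ` D' \<subseteq> tokens" using D'(3) by (auto simp: saves_def)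
  have "card (?H - D') \<le> card (tokens - g' ` D')"
    using enough D'(1,2) img fin by (simp add: card_Diff_subset card_image)
  then obtain q where q: "q ` (?H - D') \<subseteq> tokens - g' ` D'" "inj_on q (?H - D')"
    by (metis card_le_inj finite_Diff finite_Un finite_defs(2-4))
  define f where "f h = (if h \<in> D' then g' h else q h)" for h
  have f_inj: "inj_on f ?H"
  proof -
    have "inj_on f (D' \<union> (?H - D'))"
    proof (unfold inj_on_Un, intro conjI)
      show "inj_on f D'" using D'(2) by (subst inj_on_cong[of _ _ g']) (auto simp: f_def)
      show "inj_on f (?H - D')" using q(2) by (subst inj_on_cong[of _ _ q]) (auto simp: f_def)
      show "f ` (D' - (?H - D')) \<inter> f ` ((?H - D') - D') = {}"
      proof -
        have "f ` D' = g' ` D'" by (simp add: f_def)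
        moreover have "f ` (?H - D') = q ` (?H - D')" by (simp add: f_def)
        ultimately show ?thesis using q(1) by blast
      qed
    qed
    then show ?thesis using D'(1) by (simp add: Un_absorb1)
  qed
  have f_img: "f ` ?H \<subseteq> tokens" using q img by (auto simp: f_def)
  \<comment> \<open>\<open>e h\<close> is the saving at \<open>h\<close>: one step for a matched
    hole, and the second step of the token on \<open>v\<close>.\<close>
  define e where "e h = (of_bool (h \<in> D') + of_bool (bonus = 1 \<and> h \<in> D' \<and> g' h = v) :: nat)" for h
  define L where "L h = (if h \<in> K then 2 else 3) - e h" for h
  have bonus1: "bonus = 1 \<longleftrightarrow> v \<in> S \<and> indep_holes \<noteq> {}" by (simp add: bonus_def)
  have vI: "h \<in> indep_holes" if "bonus = 1" "h \<in> D'" "g' h = v" for h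
    using D'(3)[OF that(2)] that bonus1 by (auto simp: saves_def)
  have walk: "\<exists>d\<le>L h. (adj E ^^ d) (f h) h" if h: "h \<in> ?H" for h
  proof -
    obtain d where d: "(adj E ^^ d) (f h) h" "d \<le> (if h \<in> K then 2 else 3) - of_bool (saves (f h) h)
      - of_bool (f h = v \<and> indep_holes \<noteq> {} \<and> h \<in> indep_holes)"
      using walk_token[of "f h" h] f_img h by blast
    moreover have "e h \<le> of_bool (saves (f h) h) + of_bool (f h = v \<and> indep_holes \<noteq> {} \<and> h \<in> indep_holes)"
      using D'(3) vI by (auto simp: e_def f_def bonus1)
    ultimately have "d \<le> L h" by (simp add: L_def)
    with d show ?thesis by blast
  qed
  have "f ` ?H \<subseteq> S" using f_img by (auto simp: tokens_def)
  then obtain l where l: "l \<le> sum L ?H" "(slide V E ^^ l) S ((S - f ` ?H) \<union> ?H)"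
    using slide_to_holes[OF _ _ f_inj _ graph walk, of S] holes_eq by auto
  have "required \<subseteq> (S - f ` ?H) \<union> ?H"
    using f_img part v_cases by (auto simp: defs)
  moreover have "(S - f ` ?H) \<union> ?H \<subseteq> V" using S part by (auto simp: defs)
  ultimately have "vertex_cover V E ((S - f ` ?H) \<union> ?H)" by (rule vertex_cover_required)
  moreover have "sum L ?H \<le> b"
  proof -
    \<comment> \<open>The subtraction in \<open>L\<close> is not truncated, so costs and savings can
      be summed separately.\<close>
    have e2: "e h \<le> (if h \<in> K then 2 else 3)" for h by (auto simp: e_def)
    have "sum L ?H + sum e ?H = (\<Sum>h\<in>?H. if h \<in> K then 2 else 3)"
      unfolding sum.distrib[symmetric] by (rule sum.cong) (use e2 in \<open>auto simp: L_def\<close>)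
    also have "\<dots> = (\<Sum>h\<in>clique_holes. if h \<in> K then 2 else 3) + (\<Sum>h\<in>indep_holes. if h \<in> K then 2 else 3)"
      using disjoint_holes by (intro sum.union_disjoint) auto
    also have "(\<Sum>h\<in>clique_holes. if h \<in> K then 2 else 3) = 2 * card clique_holes"
      by (subst sum.cong[OF refl, of _ _ "\<lambda>_. 2"]) (auto simp: defs)
    also have "(\<Sum>h\<in>indep_holes. if h \<in> K then 2 else 3) = 3 * card indep_holes"
      using part by (subst sum.cong[OF refl, of _ _ "\<lambda>_. 3"]) (auto simp: defs)
    finally have 1: "sum L ?H + sum e ?H = 2 * card clique_holes + 3 * card indep_holes" .
    have "card D' + bonus \<le> sum e ?H"
    proof -
      have "card D' = (\<Sum>h\<in>?H. of_bool (h \<in> D'))"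
        using D'(1) by (simp add: sum.If_cases of_bool_def Int_absorb1)
      moreover have "bonus \<le> (\<Sum>h\<in>?H. of_bool (bonus = 1 \<and> h \<in> D' \<and> g' h = v))"
      proof (cases "bonus = 1")
        case True
        with D'(5) obtain h where h: "h \<in> D'" "g' h = v" by blast
        have "of_bool (bonus = 1 \<and> h \<in> D' \<and> g' h = v) \<le> (\<Sum>h\<in>?H. of_bool (bonus = 1 \<and> h \<in> D' \<and> g' h = v) :: nat)"
          using h D'(1) by (intro member_le_sum) auto
        with h True show ?thesis by simp
      qed (auto simp: bonus_def of_bool_def split: if_splits)
      ultimately show ?thesis unfolding e_def sum.distrib by linarith
    qed
    with 1 cost D'(4) show ?thesis by linarith
  qed
  ultimately show ?thesis using l unfolding vertex_cover_discovery_def by (meson le_trans)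
qed

text \<open>Slides leave isolated vertices unchanged, so \<open>S\<close> and \<open>C\<close> have
  equally many tokens on the others. A hole is never isolated, as it gets filled; comparing
  cardinalities on the non-isolated vertices gives the bound.\<close>

lemma enough_tokens:
  assumes "(slide V E ^^ l) S C" "required \<subseteq> C"
  shows "card (clique_holes \<union> indep_holes) \<le> card tokens"
proof -
  let ?Z = "{x. \<exists>y. adj E x y}"
  have C: "C \<subseteq> V" "card C = card S" using slides_subset_card[OF assms(1) S finite_V] by auto
  have [simp]: "finite C" using C finite_V finite_subset by blast
  have "C - ?Z = S - ?Z" using slides_isolated[OF assms(1)] by auto
  then have "card (C \<inter> ?Z) = card (S \<inter> ?Z)"
    using C(2) card_Diff_subset_Int[of C ?Z] card_Diff_subset_Int[of S ?Z]
      card_mono[of C "C \<inter> ?Z"] card_mono[of S "S \<inter> ?Z"] by auto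
  moreover have "card (required \<inter> ?Z) \<le> card (C \<inter> ?Z)" using assms(2) by (intro card_mono) auto
  ultimately have "card (required \<inter> ?Z) \<le> card (S \<inter> ?Z)" by simp
  then have "card (required \<inter> ?Z - S \<inter> ?Z) \<le> card (S \<inter> ?Z - required \<inter> ?Z)"
    by (simp add: card_Diff_subset_Int Int_commute)
  also have "\<dots> \<le> card tokens"
    using S part by (intro card_mono) (auto simp: defs)
  also have "required \<inter> ?Z - S \<inter> ?Z = clique_holes \<union> indep_holes"
    using slides_isolated[OF assms(1)] assms(2) unfolding holes_eq by blast
  finally show ?thesis .
qed

text \<open>For a nonnegative 1-Lipschitz \<open>p\<close>, the sum over \<open>C\<close> is at
  least the sum over \<open>required\<close>, and \<open>required \<inter> S\<close> cancels. So the
  value of the holes is at most \<open>l\<close> plus the value of the surplus tokens;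
  \<open>A\<close> lowers the former and \<open>B\<close> raises the latter.\<close>

lemma discovery_lower_bound:
  assumes l: "(slide V E ^^ l) S C" and C: "required \<subseteq> C"
    and cover: "\<And>t h. saves t h \<Longrightarrow> h \<in> A \<or> t \<in> B"
    and fin: "finite A" "finite B"
  shows "2 * card clique_holes + 3 * card indep_holes \<le> l + card A + card B + bonus"
proof -
  note C' = slides_subset_card[OF l S finite_V]
  have potential: "sum p (required - S) \<le> sum p (S - required) + int l"
    if lip: "\<And>x y. adj E x y \<Longrightarrow> p y \<le> p x + 1" and nonneg: "\<And>x. 0 \<le> p x" for p :: "'a \<Rightarrow> int"
  proof -
    have "finite C" using C' finite_V finite_subset by blast
    then have "sum p required \<le> sum p C" using C nonneg by (intro sum_mono2) auto
    also have "\<dots> \<le> sum p S + int l" using slides_potential[OF l S finite_V] lip by blast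
    finally have "sum p required \<le> sum p S + int l" .
    moreover have "sum p required = sum p (required - S) + sum p (required \<inter> S)"
      using sum.Int_Diff[of required p S] by simp
    moreover have "sum p S = sum p (S - required) + sum p (required \<inter> S)"
      using sum.Int_Diff[of S p required] by (simp add: Int_commute)
    ultimately show ?thesis by simp
  qed
  have card_bool: "(\<Sum>x\<in>X. of_bool (x \<in> Y) :: int) \<le> int (card Y)" if "finite X" "finite Y" for X Y :: "'a set"
    using that by (simp add: of_bool_def sum.If_cases card_mono)
  show ?thesis
  \<comment> \<open>The potential of the second case needs value at least \<open>1\<close> at
    \<open>v\<close>, as clique vertices may have value \<open>2\<close>. In the case split off here
    it would be \<open>0\<close>; but then \<open>v\<close> saves a step at every clique hole, so
    \<open>A\<close> contains them all and the indicator of \<open>K - {v}\<close> is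
    enough.\<close>
  proof (cases "v \<in> S \<and> indep_holes = {} \<and> v \<notin> B")
    case True
    define p :: "'a \<Rightarrow> int" where "p x = of_bool (x \<in> K - {v})" for x
    have "sum p (required - S) \<le> sum p (S - required) + int l"
      by (rule potential) (auto simp: p_def)
    moreover have "sum p (required - S) = int (card clique_holes)"
    proof -
      have "sum p clique_holes = (\<Sum>_\<in>clique_holes. 1)"
        by (rule sum.cong) (auto simp: p_def clique_holes_def)
      then show ?thesis using True by (simp add: holes_eq[symmetric])
    qed
    moreover have "sum p (S - required) = 0"
      by (rule sum.neutral) (auto simp: p_def required_def)
    ultimately have "card clique_holes \<le> l" by linarith
    moreover have "clique_holes \<subseteq> A"
      using True cover[of v] by (auto simp: saves_def tokens_def)
    then have "card clique_holes \<le> card A" using fin by (intro card_mono)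
    ultimately show ?thesis using True by simp
  next
    case False
    text \<open>\<open>p\<close> is the dual solution given by the cover \<open>A\<close>, \<open>B\<close>: the value of a hole is its generic
      cost, minus \<open>1\<close> if it is in \<open>A\<close>, and the value of a token is \<open>1\<close> if it is in \<open>B\<close> and \<open>0\<close> if
      it is in \<open>U\<close>; isolated tokens, which never move, have value \<open>0\<close>.\<close>
    define U where "U = {t \<in> tokens - B. t \<noteq> v}"
    define p :: "'a \<Rightarrow> int" where
      "p x = (if x = v then if v \<in> S then int bonus + of_bool (v \<in> B) else 2
              else if x \<in> K then if \<exists>t\<in>U. adj E t x then 1 else 2
              else if adj E v x then if x \<in> A \<union> S then 2 else 3
              else if (\<exists>y. adj E x y) \<and> x \<notin> U then 1 else 0)" for x
    have pv: "p v = 1 \<or> p v = 2" using False by (auto simp: p_def bonus_def)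
    have pK: "p x = 1 \<or> p x = 2" if "x \<in> K" for x using that pv by (auto simp: p_def)
    \<comment> \<open>A hole that is a neighbour \<open>x\<close> of a token outside
      \<open>B\<close>, or a non-clique neighbour of such an \<open>x\<close>, forms a saving pair
      with that token and so must lie in \<open>A\<close>. This is where the cover property yields
      the Lipschitz condition.\<close>
    have U_saves: "saves t h" if "t \<in> U" "adj E t x" "h = x \<or> adj E x h \<and> h \<notin> K" "h \<in> required - S" for t x h
    proof -
      have t: "t \<in> I" "t \<in> tokens" "t \<noteq> v" using that by (auto simp: U_def tokens_def)
      then have "x \<in> K" using that adj_indepD by blast
      with t that part show ?thesis by (auto simp: saves_def holes_eq insert_commute)
    qed
    have U_cover: "h \<in> A" if "t \<in> U" "adj E t x" "h = x \<or> adj E x h \<and> h \<notin> K" "h \<in> required - S" for t x h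
      using cover[OF U_saves[OF that]] that(1) by (auto simp: U_def)
    \<comment> \<open>Values on \<open>K\<close> are \<open>1\<close> or \<open>2\<close>, so only
      the extreme values in \<open>I\<close> are critical: next to a \<open>3\<close> the clique
      value must be \<open>2\<close>, next to a \<open>0\<close> it must be
      \<open>1\<close>.\<close>
    have lip1: "\<bar>p x - p y\<bar> \<le> 1" if xy: "adj E x y" "x \<in> K" for x y
    proof (cases "y \<in> K")
      case True
      then show ?thesis using pK[of x] pK[of y] xy by auto
    next
      case yK: False
      then have y: "y \<in> I" "y \<noteq> v" using adjD[OF xy(1)] part v_cases by auto
      have yx: "adj E y x" using xy by (simp add: insert_commute)
      show ?thesis
      proof (cases "adj E v y")
        case vy: True
        have "p x = 2" if "y \<notin> A" "y \<notin> S"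
        proof (cases "x = v")
          case True
          have "y \<in> indep_holes" using y vy that by (simp add: indep_holes_def)
          then have "v \<in> B" if "v \<in> S"
            using that \<open>y \<notin> A\<close> cover[of v y] by (auto simp: saves_def tokens_def)
          with True \<open>y \<in> indep_holes\<close> show ?thesis by (auto simp: p_def bonus_def)
        next
          case xv: False
          have "y \<in> required - S" using y vy that by (simp add: required_def)
          then have "\<not> (\<exists>t\<in>U. adj E t x)" using U_cover[of _ x y] xy(1) yK that(1) by blast
          then show ?thesis using xv xy by (simp add: p_def)
        qed
        moreover have "p y = (if y \<in> A \<union> S then 2 else 3)" using y(2) yK vy unfolding p_def by auto
        ultimately show ?thesis using pK[OF xy(2)] by auto
      next
        case vy: False
        then have xv: "x \<noteq> v" using xy by auto
        have "p x = 1" if "y \<in> U" using that xv xy(2) yx by (auto simp: p_def)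
        moreover have "p y = (if y \<in> U then 0 else 1)" using y(2) yK vy yx unfolding p_def by auto
        ultimately show ?thesis using pK[OF xy(2)] by auto
      qed
    qed
    have "sum p (required - S) \<le> sum p (S - required) + int l"
    proof (rule potential)
      fix x y assume xy: "adj E x y"
      then consider "x \<in> K" | "y \<in> K" using adj_indepD part adjD[OF xy] by blast
      then show "p y \<le> p x + 1"
        using lip1[of x y] lip1[of y x] xy by cases (auto simp: insert_commute)
    qed (auto simp: p_def)
    moreover have "2 * int (card clique_holes) + 3 * int (card indep_holes) - int (card A) \<le> sum p (required - S)"
    proof -
      have "2 - of_bool (h \<in> A) \<le> p h" if h: "h \<in> clique_holes" for h
      proof -
        have "h \<in> K" "h \<noteq> v" "h \<in> required - S" using h holes_eq by (auto simp: clique_holes_def)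
        then show ?thesis using U_cover[of _ h h] by (auto simp: p_def)
      qed
      then have "(\<Sum>h\<in>clique_holes. 2 - of_bool (h \<in> A)) \<le> sum p clique_holes" by (rule sum_mono)
      moreover have "3 - of_bool (h \<in> A) \<le> p h" if h: "h \<in> indep_holes" for h
        using h part adjD[of v h] by (auto simp: p_def indep_holes_def)
      then have "(\<Sum>h\<in>indep_holes. 3 - of_bool (h \<in> A)) \<le> sum p indep_holes" by (rule sum_mono)
      moreover have "sum p (required - S) = sum p clique_holes + sum p indep_holes"
        unfolding holes_eq[symmetric] using disjoint_holes by (intro sum.union_disjoint) auto
      moreover have "(\<Sum>h\<in>clique_holes. of_bool (h \<in> A)) + (\<Sum>h\<in>indep_holes. of_bool (h \<in> A)) \<le> int (card A)"
        using card_bool[of "clique_holes \<union> indep_holes" A] fin disjoint_holes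
        by (subst (asm) sum.union_disjoint) auto
      ultimately show ?thesis by (simp add: sum_subtractf)
    qed
    moreover have "sum p (S - required) \<le> int (card B) + int bonus"
    proof -
      have "p x \<le> of_bool (x \<in> B) + (if x = v then int bonus else 0)" if x: "x \<in> S - required" for x
      proof (cases "x = v")
        case False
        with x have "x \<in> I" "x \<notin> K" "\<not> adj E v x" using S part by (auto simp: required_def)
        then show ?thesis using False x by (auto simp: p_def U_def tokens_def)
      qed (use x in \<open>simp add: p_def\<close>)
      then have "sum p (S - required) \<le> (\<Sum>x\<in>S - required. of_bool (x \<in> B) + (if x = v then int bonus else 0))"
        by (rule sum_mono)
      also have "\<dots> \<le> int (card B) + int bonus"
        using card_bool[of "S - required" B] fin by (simp add: sum.distrib)
      finally show ?thesis .
    qed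
    ultimately show ?thesis by linarith
  qed
qed

end

section \<open>Vertex covers of split graphs, and recovering a partition from the degrees\<close>

lemma split_vertex_cover_cases:
  assumes "simple_graph V E" "K \<union> I = V" "clique E K" "vertex_cover V E C" "z \<notin> V"
  obtains v where "v \<in> K \<or> v = z" "(K - {v}) \<union> {x \<in> I. adj E v x} \<subseteq> C"
proof (cases "K \<subseteq> C")
  case True
  moreover have "\<not> adj E z x" for x using simple_graph_adjD[OF assms(1), of z x] assms(5) by blast
  ultimately show ?thesis using that[of z] by blast
next
  case False
  then obtain v where v: "v \<in> K" "v \<notin> C" by blast
  have "x \<in> C" if "adj E v x" for x using assms(4) v that by (auto simp: vertex_cover_def)
  moreover have "adj E v x" if "x \<in> K" "x \<noteq> v" for x using that v assms(3) by (auto simp: clique_def)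
  ultimately show ?thesis using that[of v] v by blast
qed

text \<open>In a clique part \<open>K\<close> of least size every vertex has a neighbour outside,
  since otherwise it could move to the independent set. So degrees in \<open>K\<close> are at least
  \<open>card K\<close>, and those outside at most \<open>card K\<close>; only the ties decide
  between the thresholds \<open>card K - 1\<close> and \<open>card K\<close>.\<close>

lemma split_graph_degree_threshold:
  assumes "split_graph V E"
  obtains d where "d \<le> card V" "clique E {x \<in> V. d < card {y. adj E x y}}"
    "independent_set E {x \<in> V. \<not> d < card {y. adj E x y}}"
proof -
  let ?deg = "\<lambda>x. card {y. adj E x y}"
  have graph: "simple_graph V E" using assms by (simp add: split_graph_def)
  then have "finite V" by (simp add: simple_graph_def)
  let ?P = "\<lambda>K. K \<subseteq> V \<and> clique E K \<and> independent_set E (V - K)"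
  obtain K0 I0 where 0: "K0 \<union> I0 = V" "K0 \<inter> I0 = {}" "clique E K0" "independent_set E I0"
    using assms by (auto simp: split_graph_def)
  have "V - K0 = I0" "K0 \<subseteq> V" using 0(1,2) by blast+
  then have "?P K0" using 0(3,4) by simp
  then obtain K where K: "?P K" and least: "\<And>K'. ?P K' \<Longrightarrow> card K \<le> card K'"
    using ex_has_least_nat[of ?P K0 card] by blast
  have [simp]: "finite K" using K \<open>finite V\<close> finite_subset by blast
  have nbrs: "finite {y. adj E x y}" for x
    using simple_graph_adjD[OF graph] by (intro finite_subset[OF _ \<open>finite V\<close>]) blast
  have outside: "\<exists>i\<in>V - K. adj E k i" if k: "k \<in> K" for k
  proof (rule ccontr)
    assume none: "\<not> (\<exists>i\<in>V - K. adj E k i)"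
    have "\<not> adj E k k" using simple_graph_adjD[OF graph] by blast
    then have "independent_set E (V - (K - {k}))"
      using K none unfolding independent_set_def by (auto simp: insert_commute)
    then have "?P (K - {k})" using K by (auto simp: clique_def)
    then have "card K \<le> card (K - {k})" by (rule least)
    then show False using k by (metis \<open>finite K\<close> card_Diff1_less not_le)
  qed
  have deg_K: "card K - 1 < ?deg k" if k: "k \<in> K" for k
  proof -
    from outside[OF k] obtain i where i: "i \<in> V - K" "adj E k i" by blast
    have "insert i (K - {k}) \<subseteq> {y. adj E k y}" using K k i by (auto simp: clique_def)
    then have "card (insert i (K - {k})) \<le> ?deg k" using nbrs by (intro card_mono)
    then show ?thesis using i k by simp
  qed
  have nbrs_I: "{y. adj E i y} \<subseteq> K" if "i \<in> V - K" for i
    using K that simple_graph_adjD[OF graph] unfolding independent_set_def by blast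
  then have deg_I: "?deg i \<le> card K" if "i \<in> V - K" for i using that by (simp add: card_mono)
  text \<open>A vertex of \<open>K\<close> can only tie with a vertex of \<open>I\<close> that is adjacent to all of \<open>K\<close>. A single
    such vertex can be moved to the clique; if there are two, the degrees in \<open>K\<close> exceed \<open>card K\<close>.\<close>
  define Full where "Full = {i \<in> V - K. {y. adj E i y} = K}"
  have full: "i \<in> Full \<longleftrightarrow> ?deg i = card K" if "i \<in> V - K" for i
    using that card_subset_eq[OF \<open>finite K\<close> nbrs_I[OF that]] by (auto simp: Full_def)
  have "card K \<le> card V" using K \<open>finite V\<close> by (simp add: card_mono)
  show ?thesis
  proof (cases "\<exists>i\<in>Full. \<exists>j\<in>Full. i \<noteq> j")
    case True
    then obtain i j where ij: "i \<in> Full" "j \<in> Full" "i \<noteq> j" by blast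
    have "card K < ?deg k" if k: "k \<in> K" for k
    proof -
      have "adj E i k" "adj E j k" "i \<notin> K" "j \<notin> K" using ij k unfolding Full_def by blast+
      then have "adj E k i" "adj E k j" by (simp_all add: insert_commute)
      then have "insert i (insert j (K - {k})) \<subseteq> {y. adj E k y}" using K k by (auto simp: clique_def)
      then have "card (insert i (insert j (K - {k}))) \<le> ?deg k" using nbrs by (intro card_mono)
      then show ?thesis using ij k \<open>i \<notin> K\<close> \<open>j \<notin> K\<close> card_gt_0_iff[of K] by (auto simp: card_Suc_Diff1)
    qed
    then have "{x \<in> V. card K < ?deg x} = K" "{x \<in> V. \<not> card K < ?deg x} = V - K"
      using K deg_I by fastforce+
    then show ?thesis using that[of "card K"] K \<open>card K \<le> card V\<close> by simp
  next
    case False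
    show ?thesis
    \<comment> \<open>For empty \<open>K\<close> the truncated \<open>card K - 1\<close> is
      \<open>0\<close>, and the vertices in \<open>Full\<close> no longer exceed it.\<close>
    proof (cases "K = {}")
      case True
      then have sets: "{x \<in> V. 0 < ?deg x} = {}" "{x \<in> V. \<not> 0 < ?deg x} = V"
        using deg_I by auto
      show ?thesis
      proof (rule that[of 0])
        show "clique E {x \<in> V. 0 < ?deg x}" unfolding sets by (simp add: clique_def)
        show "independent_set E {x \<in> V. \<not> 0 < ?deg x}" unfolding sets using K True by simp
      qed simp
    next
      case nonempty: False
      then have "0 < card K" by (simp add: card_gt_0_iff)
      then have "card K - 1 < ?deg x \<longleftrightarrow> x \<in> Full" if "x \<in> V - K" for x
        using full[OF that] deg_I[OF that] by auto
      then have sets: "{x \<in> V. card K - 1 < ?deg x} = K \<union> Full" "{x \<in> V. \<not> card K - 1 < ?deg x} = V - K - Full"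
        using K deg_K by (auto simp: Full_def)
      have full_adj: "adj E i k" "adj E k i" if "i \<in> Full" "k \<in> K" for i k
        using that adj_commute[of i k E] unfolding Full_def by blast+
      have "clique E (K \<union> Full)"
        using K False full_adj unfolding clique_def by blast
      moreover have "independent_set E (V - K - Full)" using K by (auto simp: independent_set_def)
      moreover have "card K - 1 \<le> card V" using \<open>card K \<le> card V\<close> by simp
      ultimately show ?thesis using that[of "card K - 1", unfolded sets] by blast
    qed
  qed
qed

section \<open>Running times of programs\<close>

text \<open>Charging both branches of a conditional and \<open>N\<close> rounds to every loop makes
  the bound independent of the state.\<close>

primrec cost :: "nat \<Rightarrow> com \<Rightarrow> nat" where
  "cost N Skip = 1"
| "cost N (Assign x e) = 1 + acost e"
| "cost N (Write a i e) = 1 + acost i + acost e"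
| "cost N (Seq c d) = cost N c + cost N d"
| "cost N (Cond p c d) = 1 + bcost p + cost N c + cost N d"
| "cost N (While p c) = Suc N * (1 + bcost p) + N * cost N c"

primrec loop_depth :: "com \<Rightarrow> nat" where
  "loop_depth Skip = 0"
| "loop_depth (Assign x e) = 0"
| "loop_depth (Write a i e) = 0"
| "loop_depth (Seq c d) = max (loop_depth c) (loop_depth d)"
| "loop_depth (Cond p c d) = max (loop_depth c) (loop_depth d)"
| "loop_depth (While p c) = Suc (loop_depth c)"

lemma le_power_weaken: "(m::nat) \<le> k * N ^ i \<Longrightarrow> i \<le> j \<Longrightarrow> N \<ge> 1 \<Longrightarrow> m \<le> k * N ^ j"
  by (meson le_trans mult_le_mono2 power_increasing)

lemma cost_polynomial: "\<exists>k. \<forall>N\<ge>1. cost N c \<le> k * N ^ loop_depth c"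
proof (induction c)
  case (Seq c d)
  then obtain k l where k: "\<forall>N\<ge>1. cost N c \<le> k * N ^ loop_depth c"
    and l: "\<forall>N\<ge>1. cost N d \<le> l * N ^ loop_depth d" by blast
  have "cost N (Seq c d) \<le> (k + l) * N ^ loop_depth (Seq c d)" if "N \<ge> 1" for N
  proof -
    have "cost N c \<le> k * N ^ loop_depth (Seq c d)" "cost N d \<le> l * N ^ loop_depth (Seq c d)"
      using k l that by (auto intro: le_power_weaken)
    then show ?thesis by (simp add: add_mult_distrib)
  qed
  then show ?case by blast
next
  case (Cond p c d)
  then obtain k l where k: "\<forall>N\<ge>1. cost N c \<le> k * N ^ loop_depth c"
    and l: "\<forall>N\<ge>1. cost N d \<le> l * N ^ loop_depth d" by blast
  have "cost N (Cond p c d) \<le> (1 + bcost p + k + l) * N ^ loop_depth (Cond p c d)" if "N \<ge> 1" for N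
  proof -
    have "cost N c \<le> k * N ^ loop_depth (Cond p c d)" "cost N d \<le> l * N ^ loop_depth (Cond p c d)"
      using k l that by (auto intro: le_power_weaken)
    moreover have "1 + bcost p \<le> (1 + bcost p) * N ^ loop_depth (Cond p c d)"
      using that mult_le_mono2[of 1 "N ^ loop_depth (Cond p c d)" "1 + bcost p"] by simp
    ultimately show ?thesis by (simp add: algebra_simps)
  qed
  then show ?case by blast
next
  case (While p c)
  then obtain k where k: "\<forall>N\<ge>1. cost N c \<le> k * N ^ loop_depth c" by blast
  have "cost N (While p c) \<le> (2 * (1 + bcost p) + k) * N ^ loop_depth (While p c)" if "N \<ge> 1" for N
  proof -
    have "Suc N \<le> 2 * N ^ Suc (loop_depth c)" using that self_le_power[of N "Suc (loop_depth c)"] by linarith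
    then have "Suc N * (1 + bcost p) \<le> 2 * N ^ Suc (loop_depth c) * (1 + bcost p)" by (rule mult_right_mono) simp
    moreover have "N * cost N c \<le> N * (k * N ^ loop_depth c)"
      using k that by (intro mult_le_mono2) blast
    moreover have "(2 * (1 + bcost p) + k) * N ^ loop_depth (While p c) =
      2 * N ^ Suc (loop_depth c) * (1 + bcost p) + N * (k * N ^ loop_depth c)"
      by (simp add: algebra_simps)
    ultimately show ?thesis unfolding cost.simps by linarith
  qed
  then show ?case by blast
qed (auto intro: exI[of _ 1] exI)

lemma cost_bigo:
  assumes "loop_depth c = d"
  shows "(\<lambda>n. real (cost (Suc n) c)) \<in> O(\<lambda>n. real n ^ d)"
proof -
  obtain k where k: "\<And>N. N \<ge> 1 \<Longrightarrow> cost N c \<le> k * N ^ d" using cost_polynomial[of c] assms by blast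
  have "cost (Suc n) c \<le> k * 2 ^ d * n ^ d" if "n \<ge> 1" for n
  proof -
    have "cost (Suc n) c \<le> k * Suc n ^ d" by (rule k) simp
    also have "\<dots> \<le> k * (2 * n) ^ d" using that by (intro mult_left_mono power_mono) auto
    finally show ?thesis by (simp add: power_mult_distrib)
  qed
  then have "real (cost (Suc n) c) \<le> real (k * 2 ^ d) * real n ^ d" if "n \<ge> 1" for n
    using that of_nat_le_iff[where 'a = real, of "cost (Suc n) c" "k * 2 ^ d * n ^ d"] by simp
  then show ?thesis
    by (intro bigoI[of _ "real (k * 2 ^ d)"] eventually_sequentiallyI[of 1]) simp
qed

text \<open>
  Weakest precondition for executions in which every loop makes at most \<open>N\<close> iterations; the
  running time is then bounded by the syntactic quantity \<open>cost N c\<close>.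
\<close>

primrec wp :: "nat \<Rightarrow> nat \<Rightarrow> com \<Rightarrow> (state \<Rightarrow> bool) \<Rightarrow> state \<Rightarrow> bool" where
  "wp w N Skip Q s \<longleftrightarrow> Q s"
| "wp w N (Assign x e) Q s \<longleftrightarrow> afits w s e \<and> Q (s\<lparr>regs := (regs s)(x := aval s e)\<rparr>)"
| "wp w N (Write a i e) Q s \<longleftrightarrow> afits w s i \<and> afits w s e \<and>
     Q (s\<lparr>arrs := (arrs s)(a := (arrs s a)(aval s i := aval s e))\<rparr>)"
| "wp w N (Seq c d) Q s \<longleftrightarrow> wp w N c (wp w N d Q) s"
| "wp w N (Cond p c d) Q s \<longleftrightarrow> bfits w s p \<and> (if bval s p then wp w N c Q s else wp w N d Q s)"
| "wp w N (While p c) Q s \<longleftrightarrow> (\<exists>J. J 0 s \<and> (\<forall>k s. J k s \<longrightarrow> bfits w s p \<and>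
     (if bval s p then k < N \<and> wp w N c (J (Suc k)) s else Q s)))"

lemma wp_mono:
  assumes "wp w N c Q s" "\<And>s. Q s \<Longrightarrow> Q' s"
  shows "wp w N c Q' s"
  using assms
proof (induction c arbitrary: Q Q' s)
  case (Seq c d)
  from Seq.prems(1) show ?case
    by (auto intro: Seq.IH(1) Seq.IH(2) Seq.prems(2))
next
  case (Cond p c d)
  then show ?case by (auto split: if_splits)
next
  case (While p c)
  from While.prems show ?case by (simp split: if_splits) blast
qed auto

lemma wp_sound:
  "wp w N c Q s \<Longrightarrow> \<exists>t s'. exec w c s t s' \<and> t \<le> cost N c \<and> Q s'"
proof (induction c arbitrary: Q s)
  case Skip
  then show ?case by (intro exI[of _ 1] exI[of _ s]) (auto intro: exec.Skip[simplified])
next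
  case (Assign x e)
  then show ?case by (auto intro!: exec.Assign exI conjI)
next
  case (Write a i e)
  then show ?case by (auto intro!: exec.Write exI conjI)
next
  case (Seq c d)
  then obtain t s' where 1: "exec w c s t s'" "t \<le> cost N c" "wp w N d Q s'" by fastforce
  with Seq.IH(2) obtain t' s'' where "exec w d s' t' s''" "t' \<le> cost N d" "Q s''" by blast
  with 1 show ?case by (auto intro!: exI exec.Seq add_mono)
next
  case (Cond p c d)
  show ?case
  proof (cases "bval s p")
    case True
    with Cond.prems Cond.IH(1)[of Q s] obtain t s' where
      "exec w c s t s'" "t \<le> cost N c" "Q s'" "bfits w s p" by auto
    with True show ?thesis by (intro exI[of _ "1 + bcost p + t"] exI[of _ s']) (auto intro: exec.CondTrue[simplified])
  next
    case False
    with Cond.prems Cond.IH(2)[of Q s] obtain t s' where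
      "exec w d s t s'" "t \<le> cost N d" "Q s'" "bfits w s p" by auto
    with False show ?thesis by (intro exI[of _ "1 + bcost p + t"] exI[of _ s']) (auto intro: exec.CondFalse[simplified])
  qed
next
  case (While p c)
  then obtain J where init: "J 0 s" and J: "\<And>k s. J k s \<Longrightarrow> bfits w s p \<and>
     (if bval s p then k < N \<and> wp w N c (J (Suc k)) s else Q s)" by auto
  \<comment> \<open>Induction on the number \<open>m\<close> of iterations that the bound
    \<open>N\<close> still allows.\<close>
  have "\<exists>t s'. exec w (While p c) s t s' \<and> t \<le> Suc m * (1 + bcost p) + m * cost N c \<and> Q s'"
    if "J k s" "k + m = N" for k m s
    using that
  proof (induction m arbitrary: k s)
    case 0
    then have "\<not> bval s p" "bfits w s p" "Q s" using J[of k s] by (auto split: if_splits)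
    then show ?case by (intro exI[of _ "1 + bcost p"] exI[of _ s]) (auto intro: exec.WhileFalse[simplified])
  next
    case (Suc m)
    show ?case
    proof (cases "bval s p")
      case False
      then have "bfits w s p" "Q s" using J[OF Suc.prems(1)] by auto
      with False show ?thesis by (intro exI[of _ "1 + bcost p"] exI[of _ s]) (auto intro: exec.WhileFalse[simplified])
    next
      case True
      then have fits: "bfits w s p" and body: "wp w N c (J (Suc k)) s" using J[OF Suc.prems(1)] by auto
      from While.IH[OF body] obtain t s' where 1: "exec w c s t s'" "t \<le> cost N c" "J (Suc k) s'" by blast
      from Suc.IH[OF 1(3)] Suc.prems obtain t' s'' where
        2: "exec w (While p c) s' t' s''" "t' \<le> Suc m * (1 + bcost p) + m * cost N c" "Q s''" by auto
      have "1 + bcost p + t + t' \<le> Suc (Suc m) * (1 + bcost p) + Suc m * cost N c"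
        using 1 2 by simp
      with exec.WhileTrue[OF fits True 1(1) 2(1)] 2(3) show ?thesis by blast
    qed
  qed
  from this[OF init, of N] show ?case by simp
qed

lemma wp_decides:
  assumes "wp w N P (\<lambda>s'. regs s' 0 = of_bool Q) s"
  shows "decides_within w P s (cost N P) Q"
  using wp_sound[OF assms] unfolding decides_within_def by blast

text \<open>Register \<open>2\<close> holds the bound of all loops.\<close>

definition for_loop :: "nat \<Rightarrow> com \<Rightarrow> com" where
  "for_loop r c = Seq (Assign r (Const 0))
     (While (Less (Reg r) (Reg 2)) (Seq c (Assign r (Add (Reg r) (Const 1)))))"

lemma loop_depth_for_loop [simp]: "loop_depth (for_loop r c) = Suc (loop_depth c)"
  by (simp add: for_loop_def)

lemma wp_for_loop:
  assumes r: "r \<noteq> 2" and N: "regs s 2 = N" "Suc N < 2 ^ w"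
    and init: "J 0 (s\<lparr>regs := (regs s)(r := 0)\<rparr>)"
    and step: "\<And>k s. k < N \<Longrightarrow> J k s \<Longrightarrow> regs s r = k \<Longrightarrow> regs s 2 = N \<Longrightarrow>
      wp w N c (\<lambda>s'. regs s' r = k \<and> regs s' 2 = N \<and> J (Suc k) (s'\<lparr>regs := (regs s')(r := Suc k)\<rparr>)) s"
    and final: "\<And>s. J N s \<Longrightarrow> regs s r = N \<Longrightarrow> regs s 2 = N \<Longrightarrow> Q s"
  shows "wp w N (for_loop r c) Q s"
proof -
  have "1 < (2::nat) ^ w" "0 < (2::nat) ^ w" using N(2) by linarith+
  let ?J = "\<lambda>k s. k \<le> N \<and> J k s \<and> regs s r = k \<and> regs s 2 = N"
  have "wp w N (Seq c (Assign r (Add (Reg r) (Const 1)))) (?J (Suc k)) s" if "k < N" "?J k s" for k s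
    unfolding wp.simps
    by (rule wp_mono[OF step[of k s]]) (use that N(2) r \<open>1 < 2 ^ w\<close> in auto)
  then show ?thesis
    unfolding for_loop_def wp.simps(2,4,6)
    using init r N final \<open>1 < 2 ^ w\<close> \<open>0 < 2 ^ w\<close>
    by (intro conjI exI[of _ ?J] allI impI) (auto simp del: wp.simps)
qed

section \<open>Bipartite matching\<close>

text \<open>
  \<open>mT t = Suc h\<close> and \<open>mH h = Suc t\<close> say that the token \<open>t\<close> is matched with the hole \<open>h\<close>, and
  \<open>0\<close> stands for unmatched.
\<close>

definition matching :: "nat \<Rightarrow> (nat \<Rightarrow> nat \<Rightarrow> bool) \<Rightarrow> (nat \<Rightarrow> nat) \<Rightarrow> (nat \<Rightarrow> nat) \<Rightarrow> bool" where
  "matching N G mT mH \<longleftrightarrow>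
     (\<forall>h<N. \<forall>t. mH h = Suc t \<longrightarrow> t < N \<and> G t h \<and> mT t = Suc h) \<and>
     (\<forall>t<N. \<forall>h. mT t = Suc h \<longrightarrow> h < N \<and> mH h = Suc t)"

lemma matchingD:
  assumes "matching N G mT mH"
  shows "mH h = Suc t \<Longrightarrow> h < N \<Longrightarrow> t < N \<and> G t h \<and> mT t = Suc h"
    and "mT t = Suc h \<Longrightarrow> t < N \<Longrightarrow> h < N \<and> mH h = Suc t"
  using assms unfolding matching_def by blast+

definition matched :: "nat \<Rightarrow> (nat \<Rightarrow> nat) \<Rightarrow> nat set" where
  "matched N mH = {h. h < N \<and> mH h \<noteq> 0}"

lemma finite_matched [simp]: "finite (matched N mH)" by (simp add: matched_def)

text \<open>With \<open>m\<close> the size of a matching, this is Koenig's certificate that the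
  matching is maximum.\<close>

definition has_cover :: "nat \<Rightarrow> (nat \<Rightarrow> nat \<Rightarrow> bool) \<Rightarrow> nat \<Rightarrow> bool" where
  "has_cover N G m \<longleftrightarrow> (\<exists>A B. A \<subseteq> {..<N} \<and> B \<subseteq> {..<N} \<and> card A + card B \<le> m \<and>
     (\<forall>t<N. \<forall>h<N. G t h \<longrightarrow> h \<in> A \<or> t \<in> B))"

lemma has_cover_mono: "has_cover N G m \<Longrightarrow> m \<le> m' \<Longrightarrow> has_cover N G m'"
  unfolding has_cover_def by (meson le_trans)

text \<open>One link of an augmenting path: the free token \<open>t\<close> takes \<open>h\<close>,
  and the former partner \<open>u\<close> of \<open>h\<close>, if any, becomes the free
  token.\<close>

lemma matching_rematch:
  assumes M: "matching N G mT mH" and "t < N" "h < N" "mT t = 0" "G t h"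
  shows "mH h = 0 \<Longrightarrow> matching N G (mT(t := Suc h)) (mH(h := Suc t))"
    and "mH h = Suc u \<Longrightarrow> matching N G (mT(t := Suc h, u := 0)) (mH(h := Suc t))"
proof -
  note H = matchingD(1)[OF M] and T = matchingD(2)[OF M]
  show "matching N G (mT(t := Suc h)) (mH(h := Suc t))" if "mH h = 0"
    unfolding matching_def
  proof (intro conjI allI impI; (elim conjE)?)
    fix h' t' assume *: "h' < N" "(mH(h := Suc t)) h' = Suc t'"
    show "t' < N" "G t' h'" "(mT(t := Suc h)) t' = Suc h'"
      using H[of h' t'] * assms(2-5) by (auto split: if_splits)
  next
    fix t' h' assume *: "t' < N" "(mT(t := Suc h)) t' = Suc h'"
    show "h' < N" "(mH(h := Suc t)) h' = Suc t'"
      using T[of t' h'] * assms(2-5) that by (auto split: if_splits)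
  qed
  show "matching N G (mT(t := Suc h, u := 0)) (mH(h := Suc t))" if u: "mH h = Suc u"
    unfolding matching_def
  proof (intro conjI allI impI; (elim conjE)?)
    have "u \<noteq> t" "mT u = Suc h" using H[OF u \<open>h < N\<close>] \<open>mT t = 0\<close> by auto
    fix h' t' assume *: "h' < N" "(mH(h := Suc t)) h' = Suc t'"
    show "t' < N" "G t' h'" "(mT(t := Suc h, u := 0)) t' = Suc h'"
      using H[of h' t'] * assms(2-5) \<open>u \<noteq> t\<close> \<open>mT u = Suc h\<close> by (auto split: if_splits)
  next
    fix t' h' assume *: "t' < N" "(mT(t := Suc h, u := 0)) t' = Suc h'"
    show "h' < N" "(mH(h := Suc t)) h' = Suc t'"
      using T[of t' h'] * assms(2-5) u by (auto split: if_splits)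
  qed
qed

lemma card_matched_upd:
  assumes "h < N"
  shows "card (matched N (mH(h := Suc t))) = (if mH h = 0 then Suc (card (matched N mH)) else card (matched N mH))"
proof -
  have "matched N (mH(h := Suc t)) = insert h (matched N mH)" using assms by (auto simp: matched_def)
  moreover have "h \<in> matched N mH \<longleftrightarrow> mH h \<noteq> 0" using assms by (auto simp: matched_def)
  ultimately show ?thesis by (simp add: insert_absorb)
qed

subsection \<open>Breadth-first search for an augmenting path\<close>

text \<open>
  \<open>Q\<close> is the queue of holes, with the \<open>tail\<close> entries filled so far, and \<open>par t = Suc i\<close>
  means that the token \<open>t\<close> was discovered from the hole \<open>Q i\<close>. The last token
  \<open>t\<close> discovered that is unmatched is recorded as \<open>t0 = Suc t\<close>. The entries of \<open>Q\<close> below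
  \<open>j\<close> are completely processed, and the entry \<open>j\<close> for the tokens below \<open>k\<close>.
\<close>

definition bfs_inv where
  "bfs_inv N G mT mH Q tail par t0 j k \<longleftrightarrow>
     (\<forall>i<tail. Q i < N) \<and> inj_on Q {..<tail} \<and>
     (\<forall>t<N. \<forall>i. par t = Suc i \<longrightarrow> i < tail \<and> G t (Q i)) \<and>
     (\<forall>i<tail. \<forall>t. mH (Q i) = Suc t \<longrightarrow> (\<exists>i'<i. par t = Suc i')) \<and>
     (\<forall>h<N. mH h = 0 \<longrightarrow> h \<in> Q ` {..<tail}) \<and>
     (\<forall>t<N. \<forall>h. par t \<noteq> 0 \<and> mT t = Suc h \<longrightarrow> h \<in> Q ` {..<tail}) \<and>
     (\<forall>t<N. par t \<noteq> 0 \<and> mT t = 0 \<longrightarrow> t0 \<noteq> 0) \<and>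
     (\<forall>t. t0 = Suc t \<longrightarrow> t < N \<and> par t \<noteq> 0 \<and> mT t = 0) \<and>
     (\<forall>i<tail. \<forall>t<N. (i < j \<or> i = j \<and> t < k) \<and> G t (Q i) \<longrightarrow> par t \<noteq> 0)"

lemma bfs_invD:
  assumes "bfs_inv N G mT mH Q tail par t0 j k"
  shows "i < tail \<Longrightarrow> Q i < N" "inj_on Q {..<tail}"
    "par t = Suc i \<Longrightarrow> t < N \<Longrightarrow> i < tail \<and> G t (Q i)"
    "mH (Q i) = Suc t \<Longrightarrow> i < tail \<Longrightarrow> \<exists>i'<i. par t = Suc i'"
    "mH h = 0 \<Longrightarrow> h < N \<Longrightarrow> h \<in> Q ` {..<tail}"
    "mT t = Suc h \<Longrightarrow> par t \<noteq> 0 \<Longrightarrow> t < N \<Longrightarrow> h \<in> Q ` {..<tail}"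
    "mT t = 0 \<Longrightarrow> par t \<noteq> 0 \<Longrightarrow> t < N \<Longrightarrow> t0 \<noteq> 0"
    "t0 = Suc t \<Longrightarrow> t < N \<and> par t \<noteq> 0 \<and> mT t = 0"
    "G t (Q i) \<Longrightarrow> i < tail \<Longrightarrow> t < N \<Longrightarrow> i < j \<or> i = j \<and> t < k \<Longrightarrow> par t \<noteq> 0"
proof -
  note r1 = assms[unfolded bfs_inv_def]
  note r2 = conjunct2[OF r1]
  note r3 = conjunct2[OF r2]
  note r4 = conjunct2[OF r3]
  note r5 = conjunct2[OF r4]
  note r6 = conjunct2[OF r5]
  note r7 = conjunct2[OF r6]
  note r8 = conjunct2[OF r7]
  show "i < tail \<Longrightarrow> Q i < N" using conjunct1[OF r1] by blast
  show "inj_on Q {..<tail}" using conjunct1[OF r2] by blast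
  show "par t = Suc i \<Longrightarrow> t < N \<Longrightarrow> i < tail \<and> G t (Q i)" using conjunct1[OF r3] by blast
  show "mH (Q i) = Suc t \<Longrightarrow> i < tail \<Longrightarrow> \<exists>i'<i. par t = Suc i'" using conjunct1[OF r4] by blast
  show "mH h = 0 \<Longrightarrow> h < N \<Longrightarrow> h \<in> Q ` {..<tail}" using conjunct1[OF r5] by blast
  show "mT t = Suc h \<Longrightarrow> par t \<noteq> 0 \<Longrightarrow> t < N \<Longrightarrow> h \<in> Q ` {..<tail}" using conjunct1[OF r6] by blast
  show "mT t = 0 \<Longrightarrow> par t \<noteq> 0 \<Longrightarrow> t < N \<Longrightarrow> t0 \<noteq> 0" using conjunct1[OF r7] by blast
  show "t0 = Suc t \<Longrightarrow> t < N \<and> par t \<noteq> 0 \<and> mT t = 0" using conjunct1[OF r8] by blast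
  show "G t (Q i) \<Longrightarrow> i < tail \<Longrightarrow> t < N \<Longrightarrow> i < j \<or> i = j \<and> t < k \<Longrightarrow> par t \<noteq> 0" using conjunct2[OF r8] by blast
qed

lemma bfs_inv_tail: assumes "bfs_inv N G mT mH Q tail par t0 j k" shows "tail \<le> N"
proof -
  have "inj_on Q {..<tail}" "Q ` {..<tail} \<subseteq> {..<N}" using bfs_invD(1,2)[OF assms] by auto
  then show ?thesis using card_inj_on_le[of Q "{..<tail}" "{..<N}"] by simp
qed

lemma bfs_inv_init:
  assumes "\<And>i. i < tail \<Longrightarrow> Q i < N \<and> mH (Q i) = 0" "inj_on Q {..<tail}"
    and "\<And>h. h < N \<Longrightarrow> mH h = 0 \<Longrightarrow> h \<in> Q ` {..<tail}" "\<And>t. t < N \<Longrightarrow> par t = 0"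
  shows "bfs_inv N G mT mH Q tail par 0 0 0"
  unfolding bfs_inv_def using assms by simp

lemma bfs_inv_advance:
  assumes "bfs_inv N G mT mH Q tail par t0 j k"
    and "\<And>i t. i < tail \<Longrightarrow> t < N \<Longrightarrow> i < j' \<or> i = j' \<and> t < k' \<Longrightarrow> G t (Q i) \<Longrightarrow>
      \<not> (i < j \<or> i = j \<and> t < k) \<Longrightarrow> par t \<noteq> 0"
  shows "bfs_inv N G mT mH Q tail par t0 j' k'"
proof -
  have "\<forall>i<tail. \<forall>t<N. (i < j' \<or> i = j' \<and> t < k') \<and> G t (Q i) \<longrightarrow> par t \<noteq> 0"
    using assms(2) bfs_invD(9)[OF assms(1)] by blast
  then show ?thesis using assms(1) unfolding bfs_inv_def by (elim conjE) (intro conjI; assumption)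
qed

text \<open>The loop over queue positions runs up to \<open>N\<close> even when the queue is
  exhausted; the second alternative covers these idle rounds.\<close>

lemma bfs_inv_Suc_row:
  assumes "bfs_inv N G mT mH Q tail par t0 j k" "k = N \<or> tail \<le> j"
  shows "bfs_inv N G mT mH Q tail par t0 (Suc j) 0"
  using assms(1) by (rule bfs_inv_advance) (use assms(2) in auto)

lemma bfs_inv_skip:
  assumes "bfs_inv N G mT mH Q tail par t0 j k" "\<not> (G k (Q j) \<and> par k = 0)"
  shows "bfs_inv N G mT mH Q tail par t0 j (Suc k)"
  using assms(1) by (rule bfs_inv_advance) (use assms(2) in \<open>auto simp: less_Suc_eq\<close>)

lemma bfs_inv_found:
  assumes "bfs_inv N G mT mH Q tail par t0 j k" "G k (Q j)" "par k = 0" "j < tail" "k < N" "mT k = 0"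
    and "matching N G mT mH"
  shows "bfs_inv N G mT mH Q tail (par(k := Suc j)) (Suc k) j (Suc k)"
proof -
  note B = bfs_invD[OF assms(1)]
  let ?par = "par(k := Suc j)"
  have k: "mH h \<noteq> Suc k" if "h < N" for h
    using matchingD(1)[OF assms(7) _ that] assms(6) by force
  show ?thesis
    unfolding bfs_inv_def
  proof (intro conjI allI impI B(2))
    fix i t assume "i < tail" "mH (Q i) = Suc t"
    then show "\<exists>i'<i. ?par t = Suc i'" using B(4)[of i t] B(1)[of i] k[of "Q i"] by auto
  next
    fix t h assume "t < N" "?par t \<noteq> 0 \<and> mT t = Suc h"
    then show "h \<in> Q ` {..<tail}" using B(6)[of t h] assms(6) by (auto split: if_splits)
  next
    fix i t assume "i < tail" "t < N" "(i < j \<or> i = j \<and> t < Suc k) \<and> G t (Q i)"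
    then show "?par t \<noteq> 0" using B(9)[of t i] by (auto simp: less_Suc_eq)
  next
    fix t assume "Suc k = Suc t"
    then show "t < N" "?par t \<noteq> 0" "mT t = 0" using assms by auto
  next
    fix t i assume "t < N" "?par t = Suc i"
    then show "i < tail" "G t (Q i)" using B(3)[of t i] assms(2,4) by (auto split: if_splits)
  qed (use B(1,5) in auto)
qed

text \<open>A matched hole enters the queue only through its own token, so the partner of an
  undiscovered token is new. It is stored behind position \<open>j\<close>, which makes queue
  positions decrease along parents.\<close>

lemma bfs_inv_push:
  assumes B: "bfs_inv N G mT mH Q tail par t0 j k" and k: "G k (Q j)" "par k = 0" "j < tail" "k < N" "mT k = Suc h"
    and M: "matching N G mT mH"
  shows "bfs_inv N G mT mH (Q(tail := h)) (Suc tail) (par(k := Suc j)) t0 j (Suc k)"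
proof -
  note D = bfs_invD[OF B]
  have h: "h < N" "mH h = Suc k" using matchingD(2)[OF M k(5) k(4)] by auto
  have new: "h \<notin> Q ` {..<tail}"
  proof
    assume "h \<in> Q ` {..<tail}"
    then obtain i where "i < tail" "mH (Q i) = Suc k" using h by force
    with D(4) k(2) show False by fastforce
  qed
  let ?Q = "Q(tail := h)" and ?par = "par(k := Suc j)"
  have img: "?Q ` {..<Suc tail} = insert h (Q ` {..<tail})"
    by (auto simp: lessThan_Suc image_iff)
  show ?thesis
    unfolding bfs_inv_def img
  proof (intro conjI allI impI)
    show "inj_on ?Q {..<Suc tail}"
      using D(2) new by (auto simp: lessThan_Suc inj_on_def)
  next
    fix i assume "i < Suc tail"
    then show "?Q i < N" using D(1)[of i] h by auto
  next
    fix t i assume "t < N" "?par t = Suc i"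
    then show "i < Suc tail" "G t (?Q i)" using D(3)[of t i] k by (auto split: if_splits)
  next
    fix i t assume "i < Suc tail" "mH (?Q i) = Suc t"
    then show "\<exists>i'<i. ?par t = Suc i'"
      using D(4)[of i t] k h by (cases "i = tail") auto
  next
    fix i t assume "i < Suc tail" "t < N" "(i < j \<or> i = j \<and> t < Suc k) \<and> G t (?Q i)"
    then show "?par t \<noteq> 0" using D(9)[of t i] k(3) by (auto simp: less_Suc_eq split: if_splits)
  next
    fix h' assume "h' < N" "mH h' = 0"
    then show "h' \<in> insert h (Q ` {..<tail})" using D(5) by blast
  next
    fix t h' assume "t < N" "?par t \<noteq> 0 \<and> mT t = Suc h'"
    then show "h' \<in> insert h (Q ` {..<tail})" using D(6)[of t h'] k(5) by (auto split: if_splits)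
  next
    fix t assume "t < N" "?par t \<noteq> 0 \<and> mT t = 0"
    then show "t0 \<noteq> 0" using D(7)[of t] k(5) by (auto split: if_splits)
  next
    fix t assume "t0 = Suc t"
    then show "t < N" "?par t \<noteq> 0" "mT t = 0" using D(8)[of t] by auto
  qed
qed

text \<open>Koenig's construction after a failed search: unreached holes together with discovered
  tokens. All of these are matched, and the partner of a discovered token is a reached hole, so no
  matching edge is counted twice.\<close>

lemma bfs_inv_cover:
  assumes B: "bfs_inv N G mT mH Q tail par 0 N 0" and M: "matching N G mT mH"
  shows "has_cover N G (card (matched N mH))"
proof -
  note tail = bfs_inv_tail[OF B]
  define A where "A = {..<N} - Q ` {..<tail}"
  define T where "T = {t. t < N \<and> par t \<noteq> 0}"
  define m where "m t = mT t - 1" for t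
  have T: "mT t = Suc (m t)" "m t \<in> Q ` {..<tail}" "mH (m t) = Suc t" "m t < N" if "t \<in> T" for t
  proof -
    have t: "t < N" "par t \<noteq> 0" using that by (auto simp: T_def)
    then have "mT t \<noteq> 0" using bfs_invD(7)[OF B] by blast
    then show *: "mT t = Suc (m t)" by (simp add: m_def)
    then show "m t \<in> Q ` {..<tail}" using bfs_invD(6)[OF B *] t by blast
    show "mH (m t) = Suc t" "m t < N" using matchingD(2)[OF M * t(1)] by auto
  qed
  have "inj_on m T"
  proof (rule inj_onI)
    fix t t' assume "t \<in> T" "t' \<in> T" "m t = m t'"
    then show "t = t'" using T(3) by (metis nat.inject)
  qed
  then have "card A + card T = card A + card (m ` T)" by (simp add: card_image)
  also have "\<dots> = card (A \<union> m ` T)"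
    using T(2) by (intro card_Un_disjoint[symmetric]) (auto simp: A_def T_def)
  also have "\<dots> \<le> card (matched N mH)"
  proof (rule card_mono)
    have "mH h \<noteq> 0" if "h \<in> A" for h using bfs_invD(5)[OF B, of h] that by (auto simp: A_def)
    then show "A \<union> m ` T \<subseteq> matched N mH" using T(3,4) by (fastforce simp: matched_def A_def)
  qed simp
  finally have "card A + card T \<le> card (matched N mH)" .
  moreover have "h \<in> A \<or> t \<in> T" if th: "t < N" "h < N" "G t h" for t h
  proof (cases "h \<in> A")
    case False
    then obtain i where "i < tail" "h = Q i" using th by (auto simp: A_def)
    then show ?thesis using bfs_invD(9)[OF B, of t i] th tail by (auto simp: T_def)
  qed simp
  moreover have "A \<subseteq> {..<N}" "T \<subseteq> {..<N}" by (auto simp: A_def T_def)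
  ultimately show ?thesis unfolding has_cover_def by (intro exI[of _ A] exI[of _ T] conjI) blast+
qed

text \<open>
  Augmentation walks back along the parents with decreasing queue index; in between, every state
  is a matching, and the token \<open>t - 1\<close> is still looking for a hole.
\<close>

definition augment_inv where
  "augment_inv N G Q tail par mH0 mT mH t i \<longleftrightarrow> matching N G mT mH \<and>
     card (matched N mH) = card (matched N mH0) + of_bool (t = 0) \<and>
     (\<forall>u. t = Suc u \<longrightarrow> u < N \<and> mT u = 0 \<and> (\<exists>i'<i. par u = Suc i') \<and>
       (\<forall>q<i. q < tail \<longrightarrow> mH (Q q) = mH0 (Q q)))"

lemma augment_inv_init:
  assumes "bfs_inv N G mT mH Q tail par (Suc u) j k" "matching N G mT mH"
  shows "augment_inv N G Q tail par mH mT mH (Suc u) N"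
proof -
  have "u < N" "par u \<noteq> 0" "mT u = 0" using bfs_invD(8)[OF assms(1)] by auto
  moreover then obtain i where "par u = Suc i" by (cases "par u") auto
  moreover then have "i < tail" using bfs_invD(3)[OF assms(1)] \<open>u < N\<close> by blast
  ultimately show ?thesis using assms bfs_inv_tail[OF assms(1)] by (auto simp: augment_inv_def)
qed

lemma augment_inv_skip:
  assumes "augment_inv N G Q tail par mH0 mT mH t (Suc i)" "t = 0 \<or> par (t - 1) \<noteq> Suc i"
  shows "augment_inv N G Q tail par mH0 mT mH t i"
  using assms by (auto simp: augment_inv_def less_Suc_eq)

text \<open>Parents were recorded for the original \<open>mH0\<close>, while the step reads the
  current \<open>mH\<close>. Both agree on the queue positions still to be visited, because
  \<open>Q\<close> is injective and only later positions were overwritten.\<close>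

lemma augment_inv_step:
  assumes A: "augment_inv N G Q tail par mH0 mT mH (Suc u) (Suc i)" and par: "par u = Suc i"
    and B: "bfs_inv N G mT0 mH0 Q tail par t0 j k"
  shows "Q i < N" and "u < N"
    and "mH (Q i) = 0 \<Longrightarrow>
      augment_inv N G Q tail par mH0 (mT(u := Suc (Q i))) (mH(Q i := Suc u)) 0 i"
    and "mH (Q i) = Suc u' \<Longrightarrow> u' < N \<and>
      augment_inv N G Q tail par mH0 (mT(u := Suc (Q i), u' := 0)) (mH(Q i := Suc u)) (Suc u') i"
proof -
  have M: "matching N G mT mH" and u: "u < N" "mT u = 0"
    and keep: "\<And>q. q < Suc i \<Longrightarrow> q < tail \<Longrightarrow> mH (Q q) = mH0 (Q q)"
    using A by (auto simp: augment_inv_def)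
  have i: "i < tail" "G u (Q i)" using bfs_invD(3)[OF B par u(1)] by auto
  have Q: "Q i < N" using bfs_invD(1)[OF B i(1)] .
  show "Q i < N" "u < N" by fact+
  show "augment_inv N G Q tail par mH0 (mT(u := Suc (Q i))) (mH(Q i := Suc u)) 0 i" if "mH (Q i) = 0"
    using matching_rematch(1)[OF M u(1) Q u(2) i(2) that] A that
    by (simp add: augment_inv_def card_matched_upd[OF Q])
  show "u' < N \<and> augment_inv N G Q tail par mH0 (mT(u := Suc (Q i), u' := 0)) (mH(Q i := Suc u)) (Suc u') i"
    if m: "mH (Q i) = Suc u'"
  proof -
    have "u' < N" using matchingD(1)[OF M m Q] by blast
    moreover have "\<exists>i'<i. par u' = Suc i'"
      using bfs_invD(4)[OF B _ i(1), of u'] keep[of i] i m by simp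
    moreover have "(mH(Q i := Suc u)) (Q q) = mH0 (Q q)" if "q < i" "q < tail" for q
    proof -
      have "Q q \<noteq> Q i" using bfs_invD(2)[OF B] that i by (auto simp: inj_on_def)
      with keep[of q] that show ?thesis by simp
    qed
    ultimately show ?thesis
      using matching_rematch(2)[OF M u(1) Q u(2) i(2) m] A m
      by (simp add: augment_inv_def card_matched_upd[OF Q])
  qed
qed

text \<open>A token still searching would need a parent below position \<open>0\<close>. So the walk
  has ended at a free hole and the matching has grown.\<close>

lemma augment_inv_0: "augment_inv N G Q tail par mH0 mT mH t 0 \<Longrightarrow> t = 0"
  by (cases t) (auto simp: augment_inv_def)

section \<open>The program\<close>

text \<open>Hides \<open>2 ^ w\<close> from the simplification rules for powers.\<close>

definition word_size :: "nat \<Rightarrow> nat" where "word_size w = 2 ^ w"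

lemma fits_word_size:
  "afits w s (Const m) \<longleftrightarrow> m < word_size w"
  "afits w s (Reg x) \<longleftrightarrow> regs s x < word_size w"
  "afits w s (Read a e) \<longleftrightarrow> afits w s e \<and> arrs s a (aval s e) < word_size w"
  "afits w s (Add e f) \<longleftrightarrow> afits w s e \<and> afits w s f \<and> aval s e + aval s f < word_size w"
  "afits w s (Sub e f) \<longleftrightarrow> afits w s e \<and> afits w s f"
  "afits w s (Mul e f) \<longleftrightarrow> afits w s e \<and> afits w s f \<and> aval s e * aval s f < word_size w"
  by (simp_all add: word_size_def)

declare afits.simps [simp del] fits_word_size [simp]

definition same :: "nat set \<Rightarrow> nat set \<Rightarrow> state \<Rightarrow> state \<Rightarrow> bool" where
  "same R A s s' \<longleftrightarrow> (\<forall>r. r \<notin> R \<longrightarrow> regs s' r = regs s r) \<and> (\<forall>a. a \<notin> A \<longrightarrow> arrs s' a = arrs s a)"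

lemma card_less_Suc: "card {x. x < Suc k \<and> P x} = card {x. x < k \<and> P x} + of_bool (P k)"
proof -
  have "{x. x < Suc k \<and> P x} = (if P k then insert k {x. x < k \<and> P x} else {x. x < k \<and> P x})"
    by (auto simp: less_Suc_eq)
  then show ?thesis by simp
qed

lemma card_less_le: "card {x. x < (k::nat) \<and> P x} \<le> k"
  using card_mono[of "{..<k}" "{x. x < k \<and> P x}"] by auto

lemma index_eq_iff:
  assumes "j < N" "l < N"
  shows "i * N + j = k * N + l \<longleftrightarrow> i = k \<and> j = (l::nat)"
proof
  assume "i * N + j = k * N + l"
  then have "(j + i * N) div N = (l + k * N) div N" "(j + i * N) mod N = (l + k * N) mod N"
    by (simp_all add: add.commute)
  then show "i = k \<and> j = l" using assms by auto
qed simp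

abbreviation cell :: "nat \<Rightarrow> nat \<Rightarrow> nat \<Rightarrow> aexp" where
  "cell a i j \<equiv> Read a (Add (Mul (Reg i) (Reg 2)) (Reg j))"

abbreviation write_cell :: "nat \<Rightarrow> nat \<Rightarrow> nat \<Rightarrow> aexp \<Rightarrow> com" where
  "write_cell a i j e \<equiv> Write a (Add (Mul (Reg i) (Reg 2)) (Reg j)) e"

abbreviation nonzero :: "aexp \<Rightarrow> bexp" where
  "nonzero e \<equiv> Less (Const 0) e"

text \<open>\<open>N * N\<close> makes room for matrix indices; \<open>c\<close> will be the step
  bound, to which the final comparison adds a count; the other terms cover multiples of
  \<open>N\<close> and the literals of the program.\<close>

locale machine =
  fixes w N c :: nat
  assumes word: "N * N + 8 * N + c + 32 < 2 ^ w"
begin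

lemma small: "x \<le> 8 * N + c + 32 \<Longrightarrow> x < word_size w"
  using word unfolding word_size_def by linarith

lemma index_fits: "i < N \<Longrightarrow> j \<le> N \<Longrightarrow> i * N < word_size w \<and> i * N + j < word_size w"
proof -
  assume "i < N" "j \<le> N"
  then have "i * N \<le> N * N" by simp
  with \<open>j \<le> N\<close> show ?thesis using word unfolding word_size_def by linarith
qed

lemma SucN_fits: "Suc N < 2 ^ w" using word by linarith

lemmas for_loopI = wp_for_loop[OF _ _ SucN_fits]

end

section \<open>Adjacency matrix, degree threshold and common neighbours\<close>

text \<open>
  Registers: \<open>0\<close> and \<open>2\<close> number of vertices \<open>n\<close> and \<open>N = n + 1\<close>, \<open>1\<close> step bound, \<open>3\<close> answer,
  \<open>4\<close> degree threshold, \<open>5\<close> current \<open>v\<close>, \<open>6\<close>/\<open>7\<close>/\<open>8\<close> number of clique holes/independent holes/tokens,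
  \<open>9\<close> to \<open>12\<close> loop counters, \<open>13\<close> queue length, \<open>14\<close> token at the end of the augmenting path
  plus \<open>1\<close>, \<open>15\<close> current hole, \<open>16\<close> to \<open>18\<close> auxiliary.
  Arrays: \<open>0\<close> and \<open>1\<close> input, \<open>2\<close> adjacency matrix with row length \<open>N\<close>, \<open>3\<close> degrees, \<open>4\<close> clique,
  \<open>5\<close> matrix of the pairs with a common neighbour, \<open>6\<close> holes, \<open>7\<close> tokens, \<open>8\<close> matrix of the
  pairs that save a step, \<open>9\<close> and \<open>10\<close> matching \<open>mH\<close> and \<open>mT\<close>, \<open>11\<close> parents, \<open>12\<close> queue.
  The additional index \<open>n\<close> is an isolated vertex outside the graph, so that a loop over \<open>v < N\<close> also
  treats the covers that contain the whole clique.
\<close>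

definition setup_graph :: com where
  "setup_graph = for_loop 11 (for_loop 12
     (Cond (Less (Reg 12) (Reg 0))
       (Seq (Assign 16 (Read 0 (Add (Mul (Reg 11) (Reg 0)) (Reg 12))))
       (Seq (write_cell 2 11 12 (Reg 16))
            (Write 3 (Reg 11) (Add (Read 3 (Reg 11)) (Reg 16)))))
       Skip))"

context machine begin

lemma wp_setup_graph:
  assumes N: "regs s0 2 = N" "N = Suc n" "regs s0 0 = n"
    and A: "\<And>i j. i < N \<Longrightarrow> j < n \<Longrightarrow> arrs s0 0 (i * n + j) = of_bool (edge i j)"
    and last: "\<And>i. \<not> edge i n"
    and zero: "arrs s0 2 = (\<lambda>_. 0)" "arrs s0 3 = (\<lambda>_. 0)"
    and Q: "\<And>s. same {11,12,16} {2,3} s0 s \<Longrightarrow>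
      (\<And>i j. i < N \<Longrightarrow> j < N \<Longrightarrow> arrs s 2 (i * N + j) = of_bool (edge i j)) \<Longrightarrow>
      (\<And>i. i < N \<Longrightarrow> arrs s 3 i = card {j. j < N \<and> edge i j}) \<Longrightarrow> Q s"
  shows "wp w N setup_graph Q s0"
proof -
  define I where "I u s \<longleftrightarrow> same {11,12,16} {2,3} s0 s \<and>
    (\<forall>i<N. \<forall>j<N. arrs s 2 (i * N + j) = of_bool (i < u \<and> edge i j)) \<and>
    (\<forall>i<N. arrs s 3 i = (if i < u then card {j. j < N \<and> edge i j} else 0))" for u s
  define J where "J u k s \<longleftrightarrow> same {11,12,16} {2,3} s0 s \<and> regs s 11 = u \<and>
    (\<forall>i<N. \<forall>j<N. arrs s 2 (i * N + j) = of_bool ((i < u \<or> i = u \<and> j < k) \<and> edge i j)) \<and>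
    (\<forall>i<N. arrs s 3 i = (if i < u then card {j. j < N \<and> edge i j}
      else if i = u then card {j. j < k \<and> edge i j} else 0))" for u k s
  show ?thesis
    unfolding setup_graph_def
  proof (rule for_loopI[where J = I], goal_cases)
    case (4 u s)
    show ?case
    proof (rule for_loopI[where J = "J u"], goal_cases)
      case (4 k t)
      show ?case
      \<comment> \<open>The input has no column \<open>n\<close>: the index \<open>u * n + n\<close>
        would already belong to the next row, so the program skips it.\<close>
      proof (cases "k = n")
        case True
        then show ?thesis using 4 N(1,3) last
          by (simp add: J_def same_def small card_less_Suc) (auto simp: less_Suc_eq)
      next
        case False
        then have k: "k < n" "n \<le> N" using 4 N by simp_all
        have "u * n + k \<le> u * N + k" using N by simp
        moreover have "u * N + k < word_size w" "u * N < word_size w"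
          using index_fits[of u k] 4 \<open>u < N\<close> by auto
        moreover have "u * n \<le> u * N" using N by simp
        moreover have "arrs t 3 u \<le> k" using 4 \<open>u < N\<close> card_less_le[of k "edge u"] by (simp add: J_def)
        moreover have "u * n < word_size w" "u * n + k < word_size w"
          using calculation by linarith+
        ultimately show ?thesis using 4 k N(1,3) A[of u k] \<open>u < N\<close>
          by (simp add: J_def same_def small card_less_Suc index_eq_iff) auto
      qed
    next
      case (3)
      then show ?case using 4 by (simp add: I_def J_def same_def)
    next
      case (5 t)
      then show ?case using 4 by (simp add: I_def J_def same_def less_Suc_eq)
    qed (use 4 in simp_all)
  next
    case 3
    then show ?case using zero by (simp add: I_def same_def)
  next
    case (5 s)
    then show ?case by (intro Q) (simp_all add: I_def)
  qed (use N in simp_all)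
qed

end

definition find_threshold :: com where
  "find_threshold = for_loop 10
     (Seq (Assign 18 (Const 1))
     (Seq (for_loop 11 (for_loop 12
       (Seq (Cond (BAnd (BAnd (Less (Reg 10) (Read 3 (Reg 11))) (Less (Reg 10) (Read 3 (Reg 12))))
                        (BAnd (BNot (Eq (Reg 11) (Reg 12))) (Eq (cell 2 11 12) (Const 0))))
              (Assign 18 (Const 0)) Skip)
            (Cond (BAnd (BAnd (BNot (Less (Reg 10) (Read 3 (Reg 11)))) (BNot (Less (Reg 10) (Read 3 (Reg 12)))))
                        (nonzero (cell 2 11 12)))
              (Assign 18 (Const 0)) Skip))))
       (Cond (nonzero (Reg 18)) (Assign 4 (Reg 10)) Skip)))"

definition separates :: "(nat \<Rightarrow> nat) \<Rightarrow> (nat \<Rightarrow> nat \<Rightarrow> bool) \<Rightarrow> nat \<Rightarrow> nat \<Rightarrow> nat \<Rightarrow> bool" where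
  "separates deg edge d i j \<longleftrightarrow> (d < deg i \<and> d < deg j \<and> i \<noteq> j \<longrightarrow> edge i j) \<and>
     (\<not> d < deg i \<and> \<not> d < deg j \<longrightarrow> \<not> edge i j)"

context machine begin

lemma wp_find_threshold:
  assumes N: "regs s0 2 = N" "regs s0 4 \<le> N"
    and edge: "\<And>i j. i < N \<Longrightarrow> j < N \<Longrightarrow> arrs s0 2 (i * N + j) = of_bool (edge i j)"
    and deg: "\<And>i. i < N \<Longrightarrow> arrs s0 3 i = deg i" "\<And>i. deg i \<le> N"
    and Q: "\<And>s. same {4,10,11,12,18} {} s0 s \<Longrightarrow> regs s 4 \<le> N \<Longrightarrow>
      (\<And>d. d < N \<Longrightarrow> \<forall>i<N. \<forall>j<N. separates deg edge d i j \<Longrightarrow>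
         \<forall>i<N. \<forall>j<N. separates deg edge (regs s 4) i j) \<Longrightarrow> Q s"
  shows "wp w N find_threshold Q s0"
proof -
  let ?sep = "separates deg edge"
  have deg_fits: "deg i < word_size w" for i using deg(2)[of i] by (intro small) simp
  define I where "I k s \<longleftrightarrow> same {4,10,11,12,18} {} s0 s \<and> regs s 4 \<le> N \<and>
    ((\<exists>d<k. \<forall>i<N. \<forall>j<N. ?sep d i j) \<longrightarrow> (\<forall>i<N. \<forall>j<N. ?sep (regs s 4) i j))" for k s
  define J where "J d e k s \<longleftrightarrow> same {4,10,11,12,18} {} s0 s \<and> regs s 10 = d \<and> regs s 4 = e \<and>
    regs s 18 = of_bool (\<forall>i<k. \<forall>j<N. ?sep d i j)" for d e k s
  define L where "L d e i k s \<longleftrightarrow> same {4,10,11,12,18} {} s0 s \<and> regs s 10 = d \<and> regs s 4 = e \<and> regs s 11 = i \<and>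
    regs s 18 = of_bool ((\<forall>i'<i. \<forall>j<N. ?sep d i' j) \<and> (\<forall>j<k. ?sep d i j))" for d e i k s
  show ?thesis
    unfolding find_threshold_def
  proof (rule for_loopI[where J = I], goal_cases)
    case (4 d s)
    then have "d < N" by simp
    show ?case
      unfolding wp.simps
    proof (rule conjI, goal_cases)
      case 2
      show ?case
      proof (rule for_loopI[where J = "J d (regs s 4)"], goal_cases)
        case (4 i t)
        then have "i < N" by simp
        show ?case
        proof (rule for_loopI[where J = "L d (regs s 4) i"], goal_cases)
          case (4 j u)
          show ?case
            using 4 \<open>d < N\<close> \<open>i < N\<close> index_fits[of i j] edge[of i j]
            by (simp add: L_def same_def small deg(1) deg_fits All_less_Suc
                separates_def[of deg edge d i j])
        next
          case (5 u)
          then show ?case by (simp add: J_def L_def same_def All_less_Suc)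
        qed (use 4 in \<open>simp_all add: J_def L_def same_def\<close>)
      next
        case (5 t)
        then show ?case using 4 \<open>d < N\<close> by (simp add: I_def J_def same_def small) (auto simp: less_Suc_eq)
      qed (use 4 in \<open>simp_all add: I_def J_def same_def small\<close>)
    qed (simp add: small)
  next
    case (5 s)
    then show ?case by (intro Q) (auto simp: I_def)
  qed (use N in \<open>simp_all add: I_def same_def\<close>)
qed

end

text \<open>The diagonal of the common-neighbour matrix is used too: a vertex shares a neighbour
  with itself iff it is not isolated.\<close>

definition compute_parts :: com where
  "compute_parts = for_loop 11
     (Seq (Cond (Less (Reg 4) (Read 3 (Reg 11))) (Write 4 (Reg 11) (Const 1)) (Write 4 (Reg 11) (Const 0)))
       (for_loop 12 (Seq (write_cell 5 11 12 (Const 0))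
         (for_loop 10 (Cond (BAnd (nonzero (cell 2 11 10)) (nonzero (cell 2 12 10)))
           (write_cell 5 11 12 (Const 1)) Skip)))))"

context machine begin

lemma wp_compute_parts:
  assumes N: "regs s0 2 = N" "regs s0 4 \<le> N"
    and edge: "\<And>i j. i < N \<Longrightarrow> j < N \<Longrightarrow> arrs s0 2 (i * N + j) = of_bool (edge i j)"
    and deg: "\<And>i. i < N \<Longrightarrow> arrs s0 3 i = deg i" "\<And>i. deg i \<le> N"
    and Q: "\<And>s. same {10,11,12} {4,5} s0 s \<Longrightarrow>
      (\<And>i. i < N \<Longrightarrow> arrs s 4 i = of_bool (regs s0 4 < deg i)) \<Longrightarrow>
      (\<And>i j. i < N \<Longrightarrow> j < N \<Longrightarrow> arrs s 5 (i * N + j) = of_bool (\<exists>x<N. edge i x \<and> edge j x)) \<Longrightarrow> Q s"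
  shows "wp w N compute_parts Q s0"
proof -
  let ?com = "\<lambda>m i j. \<exists>x<m. edge i x \<and> edge j x"
  have deg_fits: "deg i < word_size w" for i using deg(2)[of i] by (intro small) simp
  define I where "I k s \<longleftrightarrow> same {10,11,12} {4,5} s0 s \<and>
    (\<forall>i<k. arrs s 4 i = of_bool (regs s0 4 < deg i)) \<and>
    (\<forall>i<k. \<forall>j<N. arrs s 5 (i * N + j) = of_bool (?com N i j))" for k s
  define J where "J i k s \<longleftrightarrow> same {10,11,12} {4,5} s0 s \<and> regs s 11 = i \<and>
    (\<forall>i'\<le>i. arrs s 4 i' = of_bool (regs s0 4 < deg i')) \<and>
    (\<forall>i'<i. \<forall>j<N. arrs s 5 (i' * N + j) = of_bool (?com N i' j)) \<and>
    (\<forall>j<k. arrs s 5 (i * N + j) = of_bool (?com N i j))" for i k s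
  define L where "L i j k s \<longleftrightarrow> same {10,11,12} {4,5} s0 s \<and> regs s 11 = i \<and> regs s 12 = j \<and>
    (\<forall>i'\<le>i. arrs s 4 i' = of_bool (regs s0 4 < deg i')) \<and>
    (\<forall>i'<i. \<forall>j<N. arrs s 5 (i' * N + j) = of_bool (?com N i' j)) \<and>
    (\<forall>j'<j. arrs s 5 (i * N + j') = of_bool (?com N i j')) \<and>
    arrs s 5 (i * N + j) = of_bool (?com k i j)" for i j k s
  show ?thesis
    unfolding compute_parts_def
  proof (rule for_loopI[where J = I], goal_cases)
    case (4 i s)
    then have i: "i < N" by simp
    have inner: "wp w N (for_loop 12 (Seq (write_cell 5 11 12 (Const 0))
         (for_loop 10 (Cond (BAnd (nonzero (cell 2 11 10)) (nonzero (cell 2 12 10)))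
           (write_cell 5 11 12 (Const 1)) Skip))))
       (\<lambda>s'. regs s' 11 = i \<and> regs s' 2 = N \<and> I (Suc i) (s'\<lparr>regs := (regs s')(11 := Suc i)\<rparr>)) t"
      if t: "J i 0 t" for t
    proof (rule for_loopI[where J = "J i"], goal_cases)
      case (4 j t)
      then have "j < N" by simp
      show ?case
        unfolding wp.simps
      proof (intro conjI, goal_cases)
        case 3
        show ?case
        proof (rule for_loopI[where J = "L i j"], goal_cases)
          case (4 x u)
          then show ?case
            using index_fits[of i x] index_fits[of j x] index_fits[of i j] i \<open>j < N\<close> edge[of i x] edge[of j x]
            by (simp add: L_def same_def small Ex_less_Suc index_eq_iff)
        next
          case (5 u)
          then show ?case using i \<open>j < N\<close> by (simp add: L_def J_def same_def All_less_Suc)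
        qed (use 4 i in \<open>simp_all add: L_def J_def same_def index_eq_iff\<close>)
      qed (use 4 i index_fits[of i j] in \<open>simp_all add: J_def small\<close>)
    next
      case (5 t)
      then show ?case using i by (simp add: I_def J_def same_def All_less_Suc)
    qed (use t N in \<open>simp_all add: J_def same_def\<close>)
    have "J i 0 (s\<lparr>arrs := (arrs s)(4 := (arrs s 4)(i := of_bool (regs s0 4 < deg i)))\<rparr>)"
      using 4 by (simp add: I_def J_def same_def less_Suc_eq_le[symmetric] All_less_Suc)
    from inner[OF this] show ?case
    proof -
      have "regs s 4 = regs s0 4" "arrs s 3 = arrs s0 3" using 4 by (simp_all add: I_def same_def)
      then show ?thesis using inner[OF \<open>J i 0 _\<close>] 4 i N
        by (cases "regs s0 4 < deg i") (simp_all add: small deg(1) deg_fits)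
    qed
  next
    case (5 s)
    then show ?case by (intro Q) (simp_all add: I_def)
  qed (use N in \<open>simp_all add: I_def same_def\<close>)
qed

end

section \<open>Holes, tokens and saving pairs for one \<open>v\<close>\<close>

definition classify :: com where
  "classify = Seq (Assign 6 (Const 0)) (Seq (Assign 7 (Const 0)) (Seq (Assign 8 (Const 0))
     (for_loop 11
       (Seq (Write 6 (Reg 11) (Const 0))
       (Seq (Write 7 (Reg 11) (Const 0))
       (Seq (Write 9 (Reg 11) (Const 0))
       (Seq (Write 10 (Reg 11) (Const 0))
       (Cond (nonzero (Read 1 (Reg 11)))
         (Cond (Eq (Reg 11) (Reg 5))
           (Seq (Write 7 (Reg 11) (Const 1)) (Assign 8 (Add (Reg 8) (Const 1))))
           (Cond (BAnd (BAnd (BNot (nonzero (Read 4 (Reg 11)))) (BNot (nonzero (cell 2 5 11)))) (nonzero (cell 5 11 11)))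
             (Seq (Write 7 (Reg 11) (Const 1)) (Assign 8 (Add (Reg 8) (Const 1)))) Skip))
         (Cond (nonzero (Read 4 (Reg 11)))
           (Cond (Eq (Reg 11) (Reg 5)) Skip
             (Seq (Write 6 (Reg 11) (Const 1)) (Assign 6 (Add (Reg 6) (Const 1)))))
           (Cond (nonzero (cell 2 5 11))
             (Seq (Write 6 (Reg 11) (Const 1)) (Assign 7 (Add (Reg 7) (Const 1)))) Skip))))))))))"

definition fill_saves :: com where
  "fill_saves = for_loop 11 (for_loop 12
     (Seq (Cond (Eq (Reg 11) (Reg 5))
            (Cond (BAnd (nonzero (Reg 7)) (nonzero (Read 4 (Reg 12)))) (Assign 16 (Const 0)) (Assign 16 (Const 1)))
            (Cond (nonzero (Read 4 (Reg 12))) (Assign 16 (cell 2 11 12)) (Assign 16 (cell 5 11 12))))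
       (write_cell 8 11 12 (Mul (Reg 16) (Mul (Read 7 (Reg 11)) (Read 6 (Reg 12)))))))"

context machine begin

lemma card_fits:
  "k < N \<Longrightarrow> card {x. x < k \<and> P x} < word_size w"
  "k < N \<Longrightarrow> Suc (card {x. x < k \<and> P x}) < word_size w"
  using card_less_le[of k P] by (simp_all add: small)

lemma wp_classify:
  fixes inS inK edge com v
  defines "hole_K \<equiv> \<lambda>x. inK x \<and> x \<noteq> v \<and> \<not> inS x"
    and "hole_I \<equiv> \<lambda>x. \<not> inK x \<and> edge v x \<and> \<not> inS x"
    and "tok \<equiv> \<lambda>x. inS x \<and> (x = v \<or> \<not> inK x \<and> \<not> edge v x \<and> com x x)"
  assumes N: "regs s0 2 = N" and v: "regs s0 5 = v" "v < N"
    and inS: "\<And>i. i < N \<Longrightarrow> arrs s0 1 i = of_bool (inS i)"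
    and inK: "\<And>i. i < N \<Longrightarrow> arrs s0 4 i = of_bool (inK i)"
    and edge: "\<And>i j. i < N \<Longrightarrow> j < N \<Longrightarrow> arrs s0 2 (i * N + j) = of_bool (edge i j)"
    and com: "\<And>i j. i < N \<Longrightarrow> j < N \<Longrightarrow> arrs s0 5 (i * N + j) = of_bool (com i j)"
    and Q: "\<And>s. same {6,7,8,11} {6,7,9,10} s0 s \<Longrightarrow>
      regs s 6 = card {x. x < N \<and> hole_K x} \<Longrightarrow> regs s 7 = card {x. x < N \<and> hole_I x} \<Longrightarrow>
      regs s 8 = card {x. x < N \<and> tok x} \<Longrightarrow>
      (\<And>i. i < N \<Longrightarrow> arrs s 6 i = of_bool (hole_K i \<or> hole_I i)) \<Longrightarrow>
      (\<And>i. i < N \<Longrightarrow> arrs s 7 i = of_bool (tok i)) \<Longrightarrow>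
      (\<And>i. i < N \<Longrightarrow> arrs s 9 i = 0) \<Longrightarrow> (\<And>i. i < N \<Longrightarrow> arrs s 10 i = 0) \<Longrightarrow> Q s"
  shows "wp w N classify Q s0"
proof -
  have kinds: "hole_K x \<longleftrightarrow> inK x \<and> x \<noteq> v \<and> \<not> inS x" "hole_I x \<longleftrightarrow> \<not> inK x \<and> edge v x \<and> \<not> inS x"
    "tok x \<longleftrightarrow> inS x \<and> (x = v \<or> \<not> inK x \<and> \<not> edge v x \<and> com x x)" for x
    by (simp_all add: hole_K_def hole_I_def tok_def)
  define I where "I k s \<longleftrightarrow> same {6,7,8,11} {6,7,9,10} s0 s \<and>
    regs s 6 = card {x. x < k \<and> hole_K x} \<and> regs s 7 = card {x. x < k \<and> hole_I x} \<and>
    regs s 8 = card {x. x < k \<and> tok x} \<and>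
    (\<forall>i<k. arrs s 6 i = of_bool (hole_K i \<or> hole_I i)) \<and> (\<forall>i<k. arrs s 7 i = of_bool (tok i)) \<and>
    (\<forall>i<k. arrs s 9 i = 0) \<and> (\<forall>i<k. arrs s 10 i = 0)" for k s
  show ?thesis
    unfolding classify_def wp.simps
  proof (intro conjI, goal_cases)
    case 4
    show ?case
    proof (rule for_loopI[where J = I], goal_cases)
      case (4 k s)
      consider "inS k" "k = v" | "inS k" "k \<noteq> v" "inK k" | "inS k" "k \<noteq> v" "\<not> inK k" "edge v k"
        | "inS k" "k \<noteq> v" "\<not> inK k" "\<not> edge v k" "com k k"
        | "inS k" "k \<noteq> v" "\<not> inK k" "\<not> edge v k" "\<not> com k k"
        | "\<not> inS k" "inK k" "k = v" | "\<not> inS k" "inK k" "k \<noteq> v"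
        | "\<not> inS k" "\<not> inK k" "edge v k" | "\<not> inS k" "\<not> inK k" "\<not> edge v k" by blast
      then show ?case
        using 4 N v index_fits[of v k] index_fits[of k k] inS[of k] inK[of k] edge[of v k] com[of k k]
          kinds[of k]
        by cases (simp_all add: I_def same_def small All_less_Suc card_less_Suc card_fits)
    next
      case (5 s)
      then show ?case by (intro Q) (simp_all add: I_def)
    qed (use N in \<open>simp_all add: I_def same_def\<close>)
  qed (simp_all add: small)
qed

lemma wp_fill_saves:
  fixes tok hole inK edge com v many
  defines "saves \<equiv> \<lambda>t h. tok t \<and> hole h \<and>
    (if t = v then \<not> (many \<and> inK h) else if inK h then edge t h else com t h)"
  assumes N: "regs s0 2 = N" and v: "regs s0 5 = v" "v < N"
    and many: "many \<longleftrightarrow> 0 < regs s0 7" "regs s0 7 \<le> N"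
    and hole: "\<And>i. i < N \<Longrightarrow> arrs s0 6 i = of_bool (hole i)"
    and tok: "\<And>i. i < N \<Longrightarrow> arrs s0 7 i = of_bool (tok i)"
    and inK: "\<And>i. i < N \<Longrightarrow> arrs s0 4 i = of_bool (inK i)"
    and edge: "\<And>i j. i < N \<Longrightarrow> j < N \<Longrightarrow> arrs s0 2 (i * N + j) = of_bool (edge i j)"
    and com: "\<And>i j. i < N \<Longrightarrow> j < N \<Longrightarrow> arrs s0 5 (i * N + j) = of_bool (com i j)"
    and Q: "\<And>s. same {11,12,16} {8} s0 s \<Longrightarrow>
      (\<And>t h. t < N \<Longrightarrow> h < N \<Longrightarrow> arrs s 8 (t * N + h) = of_bool (saves t h)) \<Longrightarrow> Q s"
  shows "wp w N fill_saves Q s0"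
proof -
  have saves_iff: "saves t h \<longleftrightarrow> tok t \<and> hole h \<and>
    (if t = v then \<not> (many \<and> inK h) else if inK h then edge t h else com t h)" for t h
    by (simp add: saves_def)
  define I where "I k s \<longleftrightarrow> same {11,12,16} {8} s0 s \<and>
    (\<forall>t<k. \<forall>h<N. arrs s 8 (t * N + h) = of_bool (saves t h))" for k s
  define J where "J t k s \<longleftrightarrow> same {11,12,16} {8} s0 s \<and> regs s 11 = t \<and>
    (\<forall>t'<t. \<forall>h<N. arrs s 8 (t' * N + h) = of_bool (saves t' h)) \<and>
    (\<forall>h<k. arrs s 8 (t * N + h) = of_bool (saves t h))" for t k s
  show ?thesis
    unfolding fill_saves_def
  proof (rule for_loopI[where J = I], goal_cases)
    case (4 t s)
    then have t: "t < N" by simp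
    show ?case
    proof (rule for_loopI[where J = "J t"], goal_cases)
      case (4 h u)
      then show ?case
        using t N v many hole[of h] tok[of t] inK[of h] edge[of t h] com[of t h] index_fits[of t h] saves_iff[of t h]
        by (cases "t = v"; cases "inK h"; simp add: J_def same_def small All_less_Suc index_eq_iff)
          blast+
    next
      case (5 u)
      then show ?case using t by (simp add: I_def J_def same_def All_less_Suc)
    qed (use 4 in \<open>simp_all add: I_def J_def same_def\<close>)
  next
    case (5 s)
    then show ?case by (intro Q) (simp_all add: I_def)
  qed (use N in \<open>simp_all add: I_def same_def\<close>)
qed

end

section \<open>Maximum matching by repeated search and augmentation\<close>

definition init_search :: com where
  "init_search = Seq (Assign 13 (Const 0)) (Seq (Assign 14 (Const 0))
     (for_loop 11 (Seq (Write 11 (Reg 11) (Const 0))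
       (Cond (Eq (Read 9 (Reg 11)) (Const 0))
         (Seq (Write 12 (Reg 13) (Reg 11)) (Assign 13 (Add (Reg 13) (Const 1)))) Skip))))"

definition search :: com where
  "search = for_loop 10 (Cond (Less (Reg 10) (Reg 13))
     (Seq (Assign 15 (Read 12 (Reg 10)))
       (for_loop 11 (Cond (BAnd (nonzero (cell 8 11 15)) (Eq (Read 11 (Reg 11)) (Const 0)))
         (Seq (Write 11 (Reg 11) (Add (Reg 10) (Const 1)))
           (Cond (Eq (Read 10 (Reg 11)) (Const 0))
             (Assign 14 (Add (Reg 11) (Const 1)))
             (Seq (Write 12 (Reg 13) (Sub (Read 10 (Reg 11)) (Const 1)))
                  (Assign 13 (Add (Reg 13) (Const 1))))))
         Skip)))
     Skip)"

text \<open>Parent positions decrease along the path, so a single sweep through the queue from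
  position \<open>N - 1\<close> down to \<open>0\<close> meets every link in order.\<close>

definition augment :: com where
  "augment = for_loop 10 (Seq (Assign 16 (Sub (Sub (Reg 2) (Const 1)) (Reg 10)))
     (Cond (BAnd (nonzero (Reg 14)) (Eq (Read 11 (Sub (Reg 14) (Const 1))) (Add (Reg 16) (Const 1))))
       (Seq (Assign 15 (Read 12 (Reg 16)))
       (Seq (Assign 17 (Read 9 (Reg 15)))
       (Seq (Write 9 (Reg 15) (Reg 14))
       (Seq (Write 10 (Sub (Reg 14) (Const 1)) (Add (Reg 15) (Const 1)))
       (Seq (Cond (nonzero (Reg 17)) (Write 10 (Sub (Reg 17) (Const 1)) (Const 0)) Skip)
            (Assign 14 (Reg 17)))))))
       Skip))"

context machine begin

lemma matching_bounds:
  assumes "matching N G mT mH"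
  shows "h < N \<Longrightarrow> mH h \<le> N" "t < N \<Longrightarrow> mT t \<le> N"
proof -
  show "mH h \<le> N" if "h < N"
  proof (cases "mH h")
    case (Suc t)
    from matchingD(1)[OF assms this that] Suc show ?thesis by simp
  qed simp
  show "mT t \<le> N" if "t < N"
  proof (cases "mT t")
    case (Suc h)
    from matchingD(2)[OF assms this that] Suc show ?thesis by simp
  qed simp
qed

lemma bfs_inv_par_le:
  assumes "bfs_inv N G mT mH Q tail par t0 j k" "t < N"
  shows "par t \<le> N"
proof (cases "par t")
  case (Suc i)
  from bfs_invD(3)[OF assms(1) this assms(2)] bfs_inv_tail[OF assms(1)] Suc show ?thesis by simp
qed simp

lemma wp_init_search:
  assumes N: "regs s0 2 = N" and M: "matching N G (arrs s0 10) (arrs s0 9)"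
    and Q: "\<And>s. same {11,13,14} {11,12} s0 s \<Longrightarrow>
      bfs_inv N G (arrs s 10) (arrs s 9) (arrs s 12) (regs s 13) (arrs s 11) (regs s 14) 0 0 \<Longrightarrow> Q s"
  shows "wp w N init_search Q s0"
proof -
  define I where "I k s \<longleftrightarrow> same {11,13,14} {11,12} s0 s \<and> regs s 14 = 0 \<and> regs s 13 \<le> k \<and>
    (\<forall>i<regs s 13. arrs s 12 i < k \<and> arrs s0 9 (arrs s 12 i) = 0) \<and>
    inj_on (arrs s 12) {..<regs s 13} \<and>
    (\<forall>h<k. arrs s0 9 h = 0 \<longrightarrow> h \<in> arrs s 12 ` {..<regs s 13}) \<and> (\<forall>t<k. arrs s 11 t = 0)" for k s
  show ?thesis
    unfolding init_search_def wp.simps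
  proof (intro conjI, goal_cases)
    case 3
    show ?case
    proof (rule for_loopI[where J = I], goal_cases)
      case (4 k s)
      let ?Q = "arrs s 12" and ?m = "regs s 13"
      have m: "?m \<le> k" and inj: "inj_on ?Q {..<?m}" and Qk: "\<And>i. i < ?m \<Longrightarrow> ?Q i < k" using 4 by (auto simp: I_def)
      have sets: "{..<Suc ?m} \<inter> {x. x \<noteq> ?m} = {..<?m}" by auto
      have "inj_on (?Q(?m := k)) {..<Suc ?m}"
        using inj Qk by (fastforce simp: lessThan_Suc inj_on_def)
      then show ?case
        using 4 N m matching_bounds(1)[OF M, of k]
        by (simp add: I_def same_def small All_less_Suc sets) (auto intro: less_SucI)
    next
      case (5 s)
      show ?case
      proof (rule Q)
        show "bfs_inv N G (arrs s 10) (arrs s 9) (arrs s 12) (regs s 13) (arrs s 11) (regs s 14) 0 0"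
          using 5 bfs_inv_init[of "regs s 13" "arrs s 12" N "arrs s0 9" "arrs s 11"] by (simp add: I_def same_def)
      qed (use 5 in \<open>simp add: I_def\<close>)
    qed (use N in \<open>simp_all add: I_def same_def\<close>)
  qed (simp_all add: small)
qed

lemma wp_search:
  assumes N: "regs s0 2 = N" and M: "matching N G (arrs s0 10) (arrs s0 9)"
    and G: "\<And>t h. t < N \<Longrightarrow> h < N \<Longrightarrow> arrs s0 8 (t * N + h) = of_bool (G t h)"
    and B: "bfs_inv N G (arrs s0 10) (arrs s0 9) (arrs s0 12) (regs s0 13) (arrs s0 11) (regs s0 14) 0 0"
    and Q: "\<And>s. same {10,11,13,14,15} {11,12} s0 s \<Longrightarrow>
      bfs_inv N G (arrs s 10) (arrs s 9) (arrs s 12) (regs s 13) (arrs s 11) (regs s 14) N 0 \<Longrightarrow> Q s"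
  shows "wp w N search Q s0"
proof -
  define I where "I j s \<longleftrightarrow> same {10,11,13,14,15} {11,12} s0 s \<and>
    bfs_inv N G (arrs s0 10) (arrs s0 9) (arrs s 12) (regs s 13) (arrs s 11) (regs s 14) j 0" for j s
  define J where "J j k s \<longleftrightarrow> same {10,11,13,14,15} {11,12} s0 s \<and> regs s 10 = j \<and> j < regs s 13 \<and>
    regs s 15 = arrs s 12 j \<and>
    bfs_inv N G (arrs s0 10) (arrs s0 9) (arrs s 12) (regs s 13) (arrs s 11) (regs s 14) j k" for j k s
  show ?thesis
    unfolding search_def
  proof (rule for_loopI[where J = I], goal_cases)
    case (4 j s)
    then have j: "j < N" and B: "bfs_inv N G (arrs s0 10) (arrs s0 9) (arrs s 12) (regs s 13) (arrs s 11) (regs s 14) j 0"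
      by (simp_all add: I_def)
    show ?case
    proof (cases "j < regs s 13")
      case False
      then show ?thesis
        using 4 bfs_inv_Suc_row[OF B] bfs_inv_tail[OF B] by (simp add: I_def same_def small)
    next
      case True
      have tail: "regs s 13 \<le> N" using bfs_inv_tail[OF B] .
      have Qj: "arrs s 12 j < N" using bfs_invD(1)[OF B True] .
      have "wp w N (Seq (Assign 15 (Read 12 (Reg 10)))
       (for_loop 11 (Cond (BAnd (nonzero (cell 8 11 15)) (Eq (Read 11 (Reg 11)) (Const 0)))
         (Seq (Write 11 (Reg 11) (Add (Reg 10) (Const 1)))
           (Cond (Eq (Read 10 (Reg 11)) (Const 0))
             (Assign 14 (Add (Reg 11) (Const 1)))
             (Seq (Write 12 (Reg 13) (Sub (Read 10 (Reg 11)) (Const 1)))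
                  (Assign 13 (Add (Reg 13) (Const 1))))))
         Skip))) (\<lambda>s'. regs s' 10 = j \<and> regs s' 2 = N \<and> I (Suc j) (s'\<lparr>regs := (regs s')(10 := Suc j)\<rparr>)) s"
        unfolding wp.simps
      proof (rule conjI, goal_cases)
        case 2
        show ?case
        proof (rule for_loopI[where J = "J j"], goal_cases)
          case (4 k u)
          then have same: "same {10,11,13,14,15} {11,12} s0 u"
            and u: "regs u 10 = j" "j < regs u 13" "regs u 15 = arrs u 12 j"
            and B: "bfs_inv N G (arrs s0 10) (arrs s0 9) (arrs u 12) (regs u 13) (arrs u 11) (regs u 14) j k"
            by (simp_all add: J_def)
          have tail: "regs u 13 \<le> N" using bfs_inv_tail[OF B] .
          have Qj: "arrs u 12 j < N" using bfs_invD(1)[OF B u(2)] .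
          have par: "arrs u 11 k \<le> N" using bfs_inv_par_le[OF B] 4 by simp
          have mT: "arrs s0 10 k \<le> N" using matching_bounds(2)[OF M] 4 by simp
          show ?case
          proof (cases "G k (arrs u 12 j) \<and> arrs u 11 k = 0")
            case False
            then show ?thesis
              using 4 u Qj index_fits[of k "arrs u 12 j"] G[of k "arrs u 12 j"] par tail same bfs_inv_skip[OF B]
              by (cases "G k (arrs u 12 j)") (simp_all add: J_def same_def small)
          next
            case found: True
            show ?thesis
            proof (cases "arrs s0 10 k")
              case 0
              then show ?thesis
                using 4 u Qj index_fits[of k "arrs u 12 j"] G[of k "arrs u 12 j"] par tail same j found
                  bfs_inv_found[OF B, of] M
                by (simp add: J_def same_def small)
            next
              case (Suc h)
              then show ?thesis
                using 4 u Qj index_fits[of k "arrs u 12 j"] G[of k "arrs u 12 j"] par tail same j found mT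
                  bfs_inv_push[OF B _ _ u(2) _ Suc M]
                by (simp add: J_def same_def small)
            qed
          qed
        next
          case (5 u)
          then show ?case by (auto simp: I_def J_def same_def intro: bfs_inv_Suc_row)
        qed (use 4 B True in \<open>simp_all add: I_def J_def same_def\<close>)
      qed (use 4 Qj in \<open>simp add: small\<close>)
      then show ?thesis using 4 True tail by (simp add: small)
    qed
  next
    case (5 s)
    then show ?case by (intro Q) (simp_all add: I_def same_def)
  qed (use N B in \<open>simp_all add: I_def same_def\<close>)
qed

end

definition maximum_matching :: com where
  "maximum_matching = for_loop 9 (Seq init_search (Seq search augment))"

text \<open>Savings are added on the right instead of subtracted on the left, where subtraction
  would truncate; \<open>+ 1\<close> turns \<open>Less\<close> into \<open>\<le>\<close>.\<close>

definition compare_cost :: com where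
  "compare_cost = Seq (for_loop 11 (Cond (nonzero (Read 9 (Reg 11))) (Assign 17 (Add (Reg 17) (Const 1))) Skip))
     (Cond (BAnd (Less (Add (Reg 6) (Reg 7)) (Add (Reg 8) (Const 1)))
                 (Less (Add (Mul (Const 2) (Reg 6)) (Mul (Const 3) (Reg 7))) (Add (Add (Reg 1) (Reg 17)) (Const 1))))
       (Assign 3 (Const 1)) Skip)"

definition accept :: com where
  "accept = Seq (Assign 17 (Const 0))
     (Seq (Cond (BAnd (nonzero (Read 1 (Reg 5))) (nonzero (Reg 7))) (Assign 17 (Const 1)) Skip)
       compare_cost)"

context machine begin

lemma wp_augment:
  assumes N: "regs s0 2 = N" and M: "matching N G (arrs s0 10) (arrs s0 9)"
    and B: "bfs_inv N G (arrs s0 10) (arrs s0 9) (arrs s0 12) (regs s0 13) (arrs s0 11) (regs s0 14) N 0"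
    and Q: "\<And>s. same {10,14,15,16,17} {9,10} s0 s \<Longrightarrow> matching N G (arrs s 10) (arrs s 9) \<Longrightarrow>
      card (matched N (arrs s 9)) = Suc (card (matched N (arrs s0 9))) \<or>
      card (matched N (arrs s 9)) = card (matched N (arrs s0 9)) \<and> has_cover N G (card (matched N (arrs s 9))) \<Longrightarrow> Q s"
  shows "wp w N augment Q s0"
proof -
  let ?Q = "arrs s0 12" and ?tail = "regs s0 13" and ?par = "arrs s0 11"
  define I where "I i s \<longleftrightarrow> same {10,14,15,16,17} {9,10} s0 s \<and>
    (if regs s0 14 = 0 then regs s 14 = 0 \<and> arrs s 9 = arrs s0 9 \<and> arrs s 10 = arrs s0 10
     else augment_inv N G ?Q ?tail ?par (arrs s0 9) (arrs s 10) (arrs s 9) (regs s 14) (N - i))" for i s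
  show ?thesis
    unfolding augment_def
  proof (rule for_loopI[where J = I], goal_cases)
    case (4 i s)
    define j where "j = N - 1 - i"
    have j: "N - i = Suc j" "N - Suc i = j" "N - 1 - i = j" "N - Suc 0 - i = j" "j < N" using 4 by (auto simp: j_def)
    have same: "same {10,14,15,16,17} {9,10} s0 s" using 4 by (simp add: I_def)
    have par: "?par t \<le> N" if "t < N" for t using bfs_inv_par_le[OF B that] .
    show ?case
    proof (cases "regs s0 14 = 0")
      case True
      \<comment> \<open>\<open>BAnd\<close> evaluates both conjuncts. Without a searching token the
        index truncates to \<open>0\<close>, and this cell must still fit into a word.\<close>
      then show ?thesis using 4 j par[of 0] by (simp add: I_def same_def small)
    next
      case False
      then have A: "augment_inv N G ?Q ?tail ?par (arrs s0 9) (arrs s 10) (arrs s 9) (regs s 14) (Suc j)"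
        using 4 j by (simp add: I_def)
      have "regs s 14 \<le> N" using A by (cases "regs s 14") (auto simp: augment_inv_def)
      then have par': "?par (regs s 14 - Suc 0) \<le> N" using j by (intro par) simp
      show ?thesis
      proof (cases "regs s 14 \<noteq> 0 \<and> ?par (regs s 14 - Suc 0) = Suc j")
        case skip: False
        then have "augment_inv N G ?Q ?tail ?par (arrs s0 9) (arrs s 10) (arrs s 9) (regs s 14) j"
          using augment_inv_skip[OF A] by auto
        then show ?thesis
          using 4 j same par' False skip \<open>regs s 14 \<le> N\<close>
          by (cases "regs s 14 = 0") (simp_all add: I_def same_def small)
      next
        case True
        then obtain u where u: "regs s 14 = Suc u" "?par u = Suc j" by (cases "regs s 14") auto
        note step = augment_inv_step[OF A[unfolded u(1)] u(2) B]
        have "matching N G (arrs s 10) (arrs s 9)" using A by (simp add: augment_inv_def)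
        then have mH: "arrs s 9 (?Q j) \<le> N" using matching_bounds(1) step(1) by blast
        show ?thesis
        proof (cases "arrs s 9 (?Q j)")
          case 0
          then show ?thesis using 4 j same par' False u step(1,2) step(3)[OF 0]
            by (simp add: I_def same_def small)
        next
          case (Suc u')
          then show ?thesis using 4 j same par' False u step(1,2) step(4)[OF Suc] mH
            by (simp add: I_def same_def small)
        qed
      qed
    qed
  next
    case (5 s)
    show ?case
    proof (cases "regs s0 14 = 0")
      case True
      then show ?thesis using 5 M B bfs_inv_cover[of N G "arrs s0 10" "arrs s0 9" ?Q ?tail ?par]
        by (intro Q) (simp_all add: I_def)
    next
      case False
      then have A: "augment_inv N G ?Q ?tail ?par (arrs s0 9) (arrs s 10) (arrs s 9) (regs s 14) 0"
        using 5 by (simp add: I_def)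
      from augment_inv_0[OF A] A 5 show ?thesis by (intro Q) (simp_all add: I_def augment_inv_def)
    qed
  next
    case 3
    show ?case
      using augment_inv_init[of N G "arrs s0 10" "arrs s0 9" ?Q ?tail ?par "regs s0 14 - 1"] B M
      by (cases "regs s0 14") (simp_all add: I_def same_def)
  qed (use N in simp_all)
qed

lemma wp_maximum_matching:
  assumes N: "regs s0 2 = N"
    and G: "\<And>t h. t < N \<Longrightarrow> h < N \<Longrightarrow> arrs s0 8 (t * N + h) = of_bool (G t h)"
    and zero: "\<And>i. i < N \<Longrightarrow> arrs s0 9 i = 0" "\<And>i. i < N \<Longrightarrow> arrs s0 10 i = 0"
    and Q: "\<And>s. same {9,10,11,13,14,15,16,17} {9,10,11,12} s0 s \<Longrightarrow> matching N G (arrs s 10) (arrs s 9) \<Longrightarrow>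
      has_cover N G (card (matched N (arrs s 9))) \<Longrightarrow> Q s"
  shows "wp w N maximum_matching Q s0"
proof -
  define I where "I k s \<longleftrightarrow> same {9,10,11,13,14,15,16,17} {9,10,11,12} s0 s \<and>
    matching N G (arrs s 10) (arrs s 9) \<and>
    (k \<le> card (matched N (arrs s 9)) \<or> has_cover N G (card (matched N (arrs s 9))))" for k s
  show ?thesis
    unfolding maximum_matching_def
  proof (rule for_loopI[where J = I], goal_cases)
    case (4 k s)
    then have same: "same {9,10,11,13,14,15,16,17} {9,10,11,12} s0 s" and M: "matching N G (arrs s 10) (arrs s 9)"
      by (simp_all add: I_def)
    show ?case
      unfolding wp.simps
    proof (rule wp_init_search[OF 4(4) M], rule wp_search[where G = G], goal_cases)
      case (5 s1 s2)
      show ?case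
      proof (rule wp_augment[where G = G], goal_cases)
        case (4 s3)
        have M': "matching N G (arrs s3 10) (arrs s3 9)" by fact
        have cards: "card (matched N (arrs s3 9)) = Suc (card (matched N (arrs s 9))) \<or>
          card (matched N (arrs s3 9)) = card (matched N (arrs s 9)) \<and> has_cover N G (card (matched N (arrs s3 9)))"
          using 4 5 by (simp add: same_def)
        have "same {9,10,11,13,14,15,16,17} {9,10,11,12} s0 s3"
          using same 4(1) 5(1,3) by (simp add: same_def)
        \<comment> \<open>A cover found earlier survives the round: either the matching keeps its
          size, or \<open>has_cover_mono\<close> raises the bound with it.\<close>
        moreover have "Suc k \<le> card (matched N (arrs s3 9)) \<or> has_cover N G (card (matched N (arrs s3 9)))"
        proof -
          have "k \<le> card (matched N (arrs s 9)) \<or> has_cover N G (card (matched N (arrs s 9)))"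
            using \<open>I k s\<close> by (simp add: I_def)
          then show ?thesis using cards
            by (elim disjE conjE) (simp_all add: has_cover_mono[OF _ le_SucI])
        qed
        moreover have "regs s3 9 = k" "regs s3 2 = N"
          using 4(1) 5(1,3) \<open>regs s 9 = k\<close> \<open>regs s 2 = N\<close> by (simp_all add: same_def)
        ultimately show ?case using M' by (simp add: I_def same_def)
      qed (use 4 5 M in \<open>simp_all add: same_def\<close>)
    qed (use 4 M G same in \<open>simp_all add: same_def\<close>)
  next
    case (5 s)
    text \<open>After \<open>N\<close> successful searches all indices of holes are matched.\<close>
    have "has_cover N G (card (matched N (arrs s 9)))" if "N \<le> card (matched N (arrs s 9))"
      unfolding has_cover_def by (rule exI[of _ "{..<N}"], rule exI[of _ "{}"]) (use that in auto)
    with 5 show ?case by (intro Q) (auto simp: I_def)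
  qed (use N zero in \<open>simp_all add: I_def same_def matching_def\<close>)
qed

lemma wp_accept:
  fixes inS v
  assumes N: "regs s0 2 = N" and v: "regs s0 5 = v" "v < N" and b: "regs s0 1 = c"
    and bounds: "regs s0 6 \<le> N" "regs s0 7 \<le> N" "regs s0 8 \<le> N"
    and inS: "\<And>i. i < N \<Longrightarrow> arrs s0 1 i = of_bool (inS i)"
    and mH: "\<And>h. h < N \<Longrightarrow> arrs s0 9 h \<le> N"
    and Q: "\<And>s. same {3,11,17} {} s0 s \<Longrightarrow>
      regs s 3 = (if regs s0 6 + regs s0 7 \<le> regs s0 8 \<and>
        2 * regs s0 6 + 3 * regs s0 7 \<le> c + card (matched N (arrs s0 9)) + of_bool (inS v \<and> regs s0 7 \<noteq> 0)
        then 1 else regs s0 3) \<Longrightarrow> Q s"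
  shows "wp w N accept Q s0"
proof -
  let ?e = "of_bool (inS v \<and> regs s0 7 \<noteq> 0) :: nat"
  define I where "I k s \<longleftrightarrow> same {11,17} {} s0 s \<and>
    regs s 17 = ?e + card {h. h < k \<and> arrs s0 9 h \<noteq> 0}" for k s
  have inner: "wp w N compare_cost Q t"
    if t: "same {11,17} {} s0 t" "regs t 17 = ?e" for t
    unfolding compare_cost_def wp.simps(4)
  proof (rule for_loopI[where J = I], goal_cases)
    case (4 k s)
    then show ?case using mH[of k] card_less_le[of k "\<lambda>h. arrs s0 9 h \<noteq> 0"]
      by (simp add: I_def same_def small card_less_Suc)
  next
    case (5 s)
    have "card {h. h < N \<and> arrs s0 9 h \<noteq> 0} \<le> N" by (rule card_less_le)
    moreover have "same {3,11,17} {} s0 s" "same {3,11,17} {} s0 (s\<lparr>regs := (regs s)(3 := 1)\<rparr>)"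
      using 5 by (simp_all add: I_def same_def)
    ultimately show ?case using 5 bounds b N Q[of s] Q[of "s\<lparr>regs := (regs s)(3 := 1)\<rparr>"]
      by (cases "inS v \<and> regs s0 7 \<noteq> 0"; cases "regs s0 6 + regs s0 7 \<le> regs s0 8";
          cases "2 * regs s0 6 + 3 * regs s0 7 \<le> c + card (matched N (arrs s0 9)) + ?e")
        (simp_all add: I_def same_def small matched_def less_Suc_eq_le)
  qed (use t N in \<open>simp_all add: I_def same_def\<close>)
  show ?thesis
    using inner[of "s0\<lparr>regs := (regs s0)(17 := ?e)\<rparr>"] bounds v inS[of v]
    by (cases "inS v"; cases "regs s0 7 = 0") (simp_all add: accept_def same_def small)
qed

end

section \<open>Correctness and depth of the whole program\<close>

definition check_vertex :: com where
  "check_vertex = Seq classify (Seq fill_saves (Seq maximum_matching accept))"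

text \<open>The negated conjunction expresses the missing disjunction: \<open>v\<close> is in the
  clique or is the extra index \<open>n\<close>.\<close>

definition discovery_program :: com where
  "discovery_program = Seq (Assign 2 (Add (Reg 0) (Const 1))) (Seq setup_graph (Seq find_threshold (Seq compute_parts
     (Seq (for_loop 5 (Cond (BNot (BAnd (BNot (nonzero (Read 4 (Reg 5)))) (BNot (Eq (Reg 5) (Reg 0))))) check_vertex Skip))
       (Assign 0 (Reg 3))))))"

text \<open>The deepest nest runs over the vertex \<open>v\<close>, the matching rounds, the queue
  positions and the tokens; the preprocessing reaches only depth \<open>3\<close>.\<close>

lemma loop_depth_discovery_program: "loop_depth discovery_program = 4"
  by (simp add: discovery_program_def setup_graph_def find_threshold_def compute_parts_def check_vertex_def
      classify_def fill_saves_def maximum_matching_def init_search_def search_def augment_def accept_def compare_cost_def)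

abbreviation reaches_required :: "nat set \<Rightarrow> nat set set \<Rightarrow> nat set \<Rightarrow> nat set \<Rightarrow> nat set \<Rightarrow> nat \<Rightarrow> nat \<Rightarrow> bool" where
  "reaches_required V E K I S b v \<equiv> \<exists>l\<le>b. \<exists>C. (slide V E ^^ l) S C \<and> split_instance.required E K I v \<subseteq> C"

context machine begin

text \<open>The computed matching makes a yes answer sound by \<open>discovery_if_matching\<close>;
  the cover of equal size makes it complete for this \<open>v\<close> by
  \<open>discovery_lower_bound\<close> and \<open>enough_tokens\<close>.\<close>

lemma wp_check_vertex:
  assumes inst: "split_instance {..<n} E K I S v" and n: "N = Suc n" and v: "v < N"
    and s0: "regs s0 1 = c" "regs s0 2 = N" "regs s0 5 = v"
    and inS: "\<And>i. i < N \<Longrightarrow> arrs s0 1 i = of_bool (i \<in> S)"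
    and K: "\<And>i. i < N \<Longrightarrow> arrs s0 4 i = of_bool (i \<in> K)"
    and edge: "\<And>i j. i < N \<Longrightarrow> j < N \<Longrightarrow> arrs s0 2 (i * N + j) = of_bool (adj E i j)"
    and com: "\<And>i j. i < N \<Longrightarrow> j < N \<Longrightarrow> arrs s0 5 (i * N + j) = of_bool (\<exists>x<N. adj E i x \<and> adj E j x)"
    and Q: "\<And>s. same {3,6,7,8,9,10,11,12,13,14,15,16,17} {6,7,8,9,10,11,12} s0 s \<Longrightarrow>
      regs s 3 = regs s0 3 \<or> regs s 3 = 1 \<and> vertex_cover_discovery {..<n} E S c \<Longrightarrow>
      (reaches_required {..<n} E K I S c v \<Longrightarrow> regs s 3 = 1) \<Longrightarrow> Q s"
  shows "wp w N check_vertex Q s0"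
proof -
  interpret split_instance "{..<n}" E K I S v by fact
  let ?com = "\<lambda>i j. \<exists>x<N. adj E i x \<and> adj E j x"
  have adj_less: "x < N" "y < N" if "adj E x y" for x y using adjD[OF that] n by simp_all
  have in_less: "x < N" if "x \<in> K \<or> x \<in> I \<or> x \<in> S" for x
  proof -
    have "x \<in> {..<n}" using that part(1) S by blast
    then show ?thesis using n by simp
  qed
  have com_eq: "?com i j \<longleftrightarrow> (\<exists>x. adj E i x \<and> adj E j x)" for i j using adj_less(2) by blast
  have not_K: "x \<notin> K \<longleftrightarrow> x \<in> I" if "x < n" for x using part that by blast
  have S_less: "x \<in> S \<Longrightarrow> x < n" for x using S by blast
  have adj_n: "adj E v x \<Longrightarrow> x < n" for x using adjD[of v x] by simp
  have sets: "{x. x < N \<and> x \<in> K \<and> x \<noteq> v \<and> x \<notin> S} = clique_holes"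
    "{x. x < N \<and> x \<notin> K \<and> adj E v x \<and> x \<notin> S} = indep_holes"
    "{x. x < N \<and> x \<in> S \<and> (x = v \<or> x \<notin> K \<and> \<not> adj E v x \<and> ?com x x)} = tokens"
    unfolding com_eq defs using in_less not_K S_less adj_n adj_less(2) by blast+
  have memb: "x \<in> K \<and> x \<noteq> v \<and> x \<notin> S \<longleftrightarrow> x \<in> clique_holes" "x \<notin> K \<and> adj E v x \<and> x \<notin> S \<longleftrightarrow> x \<in> indep_holes"
    "x \<in> S \<and> (x = v \<or> x \<notin> K \<and> \<not> adj E v x \<and> ?com x x) \<longleftrightarrow> x \<in> tokens" for x
    unfolding sets[symmetric] using in_less[of x] adj_less(2)[of v x] by blast+
  note sets_mem = sets[unfolded memb]
  have saves_eq: "t \<in> tokens \<and> (h \<in> clique_holes \<or> h \<in> indep_holes) \<and>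
      (if t = v then \<not> (0 < card indep_holes \<and> h \<in> K) else if h \<in> K then adj E t h else ?com t h) \<longleftrightarrow> saves t h" for t h
  proof -
    have "h \<in> K \<longleftrightarrow> h \<notin> indep_holes" if "h \<in> clique_holes \<or> h \<in> indep_holes"
      using that part by (auto simp: defs)
    then show ?thesis unfolding saves_def com_eq by (auto simp: card_gt_0_iff)
  qed
  have saves_less: "t < N" "h < N" if "saves t h" for t h
    using that in_less by (auto simp: saves_def defs)
  have cards: "card clique_holes \<le> N" "card indep_holes \<le> N" "card tokens \<le> N"
    unfolding sets[symmetric] by (rule card_less_le)+
  have union: "card (clique_holes \<union> indep_holes) = card clique_holes + card indep_holes"
    using disjoint_holes by (simp add: card_Un_disjoint)
  have bonus_eq: "of_bool (v \<in> S \<and> card indep_holes \<noteq> 0) = bonus"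
    by (simp add: bonus_def)
  show ?thesis
    unfolding check_vertex_def wp.simps(4)
  proof (rule wp_classify[where inS = "\<lambda>x. x \<in> S" and inK = "\<lambda>x. x \<in> K" and edge = "adj E" and com = ?com and v = v],
      unfold memb sets_mem, goal_cases)
    case (8 s1)
    note 1 = 8
    show ?case
    proof (rule wp_fill_saves[where tok = "\<lambda>x. x \<in> tokens" and hole = "\<lambda>x. x \<in> clique_holes \<or> x \<in> indep_holes"
          and inK = "\<lambda>x. x \<in> K" and edge = "adj E" and com = ?com and v = v and many = "0 < card indep_holes"],
        unfold saves_eq, goal_cases)
      case (11 s2)
      note 2 = 11
      show ?case
      proof (rule wp_maximum_matching[where G = saves], goal_cases)
        case (5 s3)
        note 3 = 5
        let ?m = "card (matched N (arrs s3 9))"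
        show ?case
        proof (rule wp_accept[where inS = "\<lambda>x. x \<in> S" and v = v], goal_cases)
          case (10 s4)
          have "same {3,6,7,8,9,10,11,12,13,14,15,16,17} {6,7,8,9,10,11,12} s0 s4"
            using 1(1) 2(1) 3(1) 10(1) by (simp add: same_def)
          moreover
          have r: "regs s3 6 = card clique_holes" "regs s3 7 = card indep_holes" "regs s3 8 = card tokens" "regs s3 3 = regs s0 3"
            using 1(1-4) 2(1) 3(1) by (simp_all add: same_def)
          have ans: "regs s4 3 = (if card (clique_holes \<union> indep_holes) \<le> card tokens \<and>
              2 * card clique_holes + 3 * card indep_holes \<le> c + ?m + bonus then 1 else regs s0 3)"
            using 10(2) unfolding r bonus_eq union .
          have "regs s4 3 = regs s0 3 \<or> regs s4 3 = 1 \<and> vertex_cover_discovery {..<n} E S c"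
          proof (cases "card (clique_holes \<union> indep_holes) \<le> card tokens \<and>
              2 * card clique_holes + 3 * card indep_holes \<le> c + ?m + bonus")
            case True
            define g where "g h = arrs s3 9 h - 1" for h
            have g: "saves (g h) h \<and> arrs s3 10 (g h) = Suc h" if "h \<in> matched N (arrs s3 9)" for h
              using matchingD(1)[OF 3(2), of h "g h"] that by (auto simp: matched_def g_def)
            have "vertex_cover_discovery {..<n} E S c"
            proof (rule discovery_if_matching)
              show "inj_on g (matched N (arrs s3 9))"
              proof (rule inj_onI)
                fix h h' assume "h \<in> matched N (arrs s3 9)" "h' \<in> matched N (arrs s3 9)" "g h = g h'"
                with g show "h = h'" by (metis nat.inject)
              qed
              show "matched N (arrs s3 9) \<subseteq> clique_holes \<union> indep_holes" using g by (auto simp: saves_def)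
            qed (use True g in auto)
            with True show ?thesis unfolding ans by simp
          qed (simp only: ans if_False simp_thms)
          moreover have "regs s4 3 = 1" if "reaches_required {..<n} E K I S c v"
          proof -
            from that obtain l C where l: "l \<le> c" "(slide {..<n} E ^^ l) S C" "required \<subseteq> C" by blast
            from 3(3) obtain A B where AB: "A \<subseteq> {..<N}" "B \<subseteq> {..<N}" "card A + card B \<le> ?m"
              "\<And>t h. t < N \<Longrightarrow> h < N \<Longrightarrow> saves t h \<Longrightarrow> h \<in> A \<or> t \<in> B" unfolding has_cover_def by blast
            have "2 * card clique_holes + 3 * card indep_holes \<le> l + card A + card B + bonus"
              by (rule discovery_lower_bound[OF l(2,3)])
                (use AB saves_less finite_subset in \<open>blast+\<close>)
            with enough_tokens[OF l(2,3)] l(1) AB(3) show ?thesis unfolding ans by simp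
          qed
          ultimately show ?case by (rule Q)
        qed (use s0 v inS 1(1-4) 2(1) 3(1) cards matching_bounds(1)[OF 3(2)] in \<open>simp_all add: same_def\<close>)
      qed (use s0 1(1,7,8) 2 in \<open>simp_all add: same_def\<close>)
    qed (use s0 v K edge com 1 cards in \<open>simp_all add: same_def\<close>)
  qed (use s0 v inS K edge com in simp_all)
qed

lemma wp_discovery_program:
  assumes split: "split_graph {..<n} E" and S: "S \<subseteq> {..<n}" and n: "N = Suc n"
  shows "wp w N discovery_program (\<lambda>s. regs s 0 = of_bool (vertex_cover_discovery {..<n} E S c))
    (encode_instance n E S c)"
proof -
  let ?V = "{..<n}"
  let ?Q = "\<lambda>s. regs s 0 = of_bool (vertex_cover_discovery {..<n} E S c)"
  define s0 where "s0 = (encode_instance n E S c)\<lparr>regs := (regs (encode_instance n E S c))(2 := N)\<rparr>"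
  define deg where "deg i = card {j. j < N \<and> adj E i j}" for i
  have graph: "simple_graph ?V E" using split by (simp add: split_graph_def)
  have adj_less: "x < n \<and> y < n" if "adj E x y" for x y using simple_graph_adjD[OF graph that] by simp
  have deg_eq: "deg i = card {j. adj E i j}" for i
    unfolding deg_def using adj_less n less_SucI by (intro arg_cong[where f = card]) blast
  have no_n: "\<not> adj E i n" for i using adj_less by blast
  have "{j. adj E n j} = {}" using adj_less by blast
  then have deg_n: "deg n = 0" unfolding deg_eq by simp
  have deg_le: "deg i \<le> N" for i unfolding deg_def by (rule card_less_le)
  have sep_iff: "(\<forall>i<N. \<forall>j<N. separates deg (adj E) d i j) \<longleftrightarrow>
    clique E {x \<in> ?V. d < deg x} \<and> independent_set E {x \<in> ?V. \<not> d < deg x}" for d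
  proof -
    \<comment> \<open>The extra index has degree \<open>0\<close> and no neighbours, so it lies on
      the independent side of every threshold without causing a violation.\<close>
    have "separates deg (adj E) d i j" if "i = n \<or> j = n" for i j
      using that adj_less[of i j] deg_n by (auto simp: separates_def)
    then have "(\<forall>i<N. \<forall>j<N. separates deg (adj E) d i j) \<longleftrightarrow> (\<forall>i<n. \<forall>j<n. separates deg (adj E) d i j)"
      unfolding n by (auto simp: less_Suc_eq)
    then show ?thesis by (auto simp: separates_def clique_def independent_set_def)
  qed
  have s0: "regs s0 0 = n" "regs s0 1 = c" "regs s0 2 = N" "regs s0 3 = 0" "regs s0 4 = 0"
    "arrs s0 2 = (\<lambda>_. 0)" "arrs s0 3 = (\<lambda>_. 0)"
    "\<And>i. i < N \<Longrightarrow> arrs s0 1 i = of_bool (i \<in> S)"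
    using S n by (auto simp: s0_def encode_instance_def)
  have A: "arrs s0 0 (i * n + j) = of_bool (adj E i j)" if "i < N" "j < n" for i j
  proof (cases "i < n")
    case True
    then have "Suc i * n \<le> n * n" by (intro mult_le_mono1) simp
    then have "i * n + j < n * n" using that by simp
    then show ?thesis using that by (simp add: s0_def encode_instance_def)
  next
    case False
    \<comment> \<open>The row of the extra index lies beyond the input matrix, where the encoding
      contains zeros.\<close>
    then have "i = n" using that n by simp
    then have "\<not> i * n + j < n * n" by simp
    then show ?thesis using that False adj_less[of i j] by (auto simp: s0_def encode_instance_def)
  qed
  have "wp w N (Seq setup_graph (Seq find_threshold (Seq compute_parts
     (Seq (for_loop 5 (Cond (BNot (BAnd (BNot (nonzero (Read 4 (Reg 5)))) (BNot (Eq (Reg 5) (Reg 0))))) check_vertex Skip))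
       (Assign 0 (Reg 3)))))) ?Q s0"
    unfolding wp.simps(4)
  proof (rule wp_setup_graph[where edge = "adj E"], goal_cases)
    case (8 s1)
    note 1 = 8[folded deg_def]
    show ?case
    proof (rule wp_find_threshold[where edge = "adj E" and deg = deg], goal_cases)
      case (6 s2)
      note 2 = 6
      show ?case
      proof (rule wp_compute_parts[where edge = "adj E" and deg = deg], goal_cases)
        case (6 s3)
        note 3 = 6
        define K where "K = {x \<in> ?V. regs s2 4 < deg x}"
        define I where "I = ?V - K"
        obtain d where "d \<le> card ?V" "clique E {x \<in> ?V. d < deg x}" "independent_set E {x \<in> ?V. \<not> d < deg x}"
          using split_graph_degree_threshold[OF split] unfolding deg_eq by blast
        then have "clique E K \<and> independent_set E {x \<in> ?V. \<not> regs s2 4 < deg x}"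
          using 2(3)[of d] unfolding sep_iff K_def by (simp add: n)
        moreover have "{x \<in> ?V. \<not> regs s2 4 < deg x} = I" by (auto simp: I_def K_def)
        ultimately have inst: "split_instance ?V E K I S v" if "v \<in> K \<or> v = n" for v
          using graph S that by unfold_locales (auto simp: I_def K_def)
        have s3: "regs s3 0 = n" "regs s3 1 = c" "regs s3 2 = N" "regs s3 3 = 0"
          "\<And>i. i < N \<Longrightarrow> arrs s3 1 i = of_bool (i \<in> S)"
          "\<And>i j. i < N \<Longrightarrow> j < N \<Longrightarrow> arrs s3 2 (i * N + j) = of_bool (adj E i j)"
          using s0 1 2(1) 3(1) by (simp_all add: same_def)
        have K: "arrs s3 4 i = of_bool (i \<in> K)" if "i < N" for i
          using 3(2)[OF that] that n deg_n by (auto simp: K_def less_Suc_eq)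
        let ?R = "{3,5,6,7,8,9,10,11,12,13,14,15,16,17}" and ?A = "{6,7,8,9,10,11,12}"
        define J where "J k s \<longleftrightarrow> same ?R ?A s3 s \<and>
          (regs s 3 = 0 \<or> regs s 3 = 1 \<and> vertex_cover_discovery ?V E S c) \<and>
          (\<forall>v<k. v \<in> K \<or> v = n \<longrightarrow> reaches_required ?V E K I S c v \<longrightarrow> regs s 3 = 1)" for k s
        show ?case
        proof (rule for_loopI[where J = J], goal_cases)
          case (4 v s)
          show ?case
          proof (cases "v \<in> K \<or> v = n")
            case False
            then show ?thesis using 4 s3 K[of v] n by (simp add: J_def same_def small All_less_Suc)
          next
            case True
            have "wp w N check_vertex (\<lambda>s'. regs s' 5 = v \<and> regs s' 2 = N \<and> J (Suc v) (s'\<lparr>regs := (regs s')(5 := Suc v)\<rparr>)) s"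
            proof (rule wp_check_vertex[OF inst[OF True] n], goal_cases)
              case (9 s')
              then show ?case using 4 by (auto simp: J_def same_def All_less_Suc)
            qed (use 4 s3 K 3(3) in \<open>simp_all add: J_def same_def\<close>)
            then show ?thesis using 4 s3 K[of v] n True
              by (cases "v = n") (simp_all add: J_def same_def small)
          qed
        next
          case (5 s)
          have "regs s 3 = 1" if "vertex_cover_discovery ?V E S c"
          proof -
            from that obtain l C where l: "l \<le> c" "(slide ?V E ^^ l) S C" "vertex_cover ?V E C"
              by (auto simp: vertex_cover_discovery_def)
            have "K \<union> I = ?V" "clique E K" using inst[of n] by (auto simp: split_instance_def)
            then obtain v where v: "v \<in> K \<or> v = n" "(K - {v}) \<union> {x \<in> I. adj E v x} \<subseteq> C"
              using split_vertex_cover_cases[OF graph _ _ l(3), of K I n] by auto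
            then have "reaches_required ?V E K I S c v"
              using l(1,2) split_instance.required_def[OF inst[OF v(1)]] by auto
            moreover have "v < N" using v(1) n by (auto simp: K_def)
            ultimately show ?thesis using 5(1) v(1) by (auto simp: J_def)
          qed
          then show ?case using 5 by (auto simp: J_def small)
        qed (use s3 in \<open>simp_all add: J_def same_def\<close>)
      qed (use s0 1 2 deg_le in \<open>simp_all add: same_def\<close>)
    qed (use s0 1 deg_le in \<open>simp_all add: same_def\<close>)
  qed (use s0 n A no_n in auto)
  moreover have "afits w (encode_instance n E S c) (Add (Reg 0) (Const 1))"
    using n by (simp add: encode_instance_def small)
  moreover have "aval (encode_instance n E S c) (Add (Reg 0) (Const 1)) = N"
    using n by (simp add: encode_instance_def)
  ultimately show ?thesis unfolding discovery_program_def wp.simps(2) wp.simps(4)[of w N "Assign _ _"]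
    by (simp only: s0_def)
qed

end

text \<open>For \<open>M = n + b + 2\<close> the left side is below \<open>64 * M ^ 2\<close>, and
  \<open>M \<ge> 2\<close> gives \<open>64 \<le> M ^ 6\<close>. This is the origin of the factor
  \<open>8\<close>.\<close>

lemma word_length_suffices:
  assumes "real 8 * log 2 (real (n + b + 2)) \<le> real w"
  shows "Suc n * Suc n + 8 * Suc n + b + 32 < 2 ^ w"
proof -
  define M where "M = n + b + 2"
  have "real (M ^ 8) = 2 powr (8 * log 2 (real M))"
    by (simp add: powr_mult_base M_def powr_powr[symmetric] mult.commute[of 8] powr_realpow)
  also have "\<dots> \<le> 2 powr real w" using assms by (simp add: M_def)
  also have "\<dots> = real (2 ^ w)" by (simp add: powr_realpow)
  finally have M8: "M ^ 8 \<le> 2 ^ w" by (simp only: of_nat_le_iff)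
  have "Suc n * Suc n \<le> M ^ 2" unfolding power2_eq_square by (rule mult_le_mono) (simp_all add: M_def)
  moreover have "8 * Suc n + b + 32 \<le> 25 * M" by (simp add: M_def)
  ultimately have "Suc n * Suc n + (8 * Suc n + b + 32) \<le> M ^ 2 + 25 * M" by (rule add_mono)
  also have "\<dots> < 64 * M ^ 2"
  proof -
    have "2 * M \<le> M ^ 2" unfolding power2_eq_square by (rule mult_right_mono) (simp_all add: M_def)
    moreover have "0 < M" by (simp add: M_def)
    ultimately show ?thesis by linarith
  qed
  also have "\<dots> \<le> M ^ 8"
  proof -
    have "2 ^ 6 \<le> M ^ 6" by (rule power_mono) (simp_all add: M_def)
    then have "M ^ 2 * 2 ^ 6 \<le> M ^ 2 * M ^ 6" by (rule mult_le_mono2)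
    also have "M ^ 2 * M ^ 6 = M ^ 8" by (simp flip: power_add)
    finally show ?thesis by simp
  qed
  also note M8
  finally show ?thesis by (simp only: add.assoc)
qed

(* The program P is fixed and must work for every word length w that is at least a constant
   multiple k of the logarithm of the numbers in the input (so b fits into a word); the time
   bound T depends on the number n of vertices only. *)
theorem theorem5:
  "\<exists>(P :: com) (k :: nat) (T :: nat \<Rightarrow> nat).
     (\<lambda>n. real (T n)) \<in> O(\<lambda>n. real n ^ 4) \<and>
     (\<forall>(n :: nat) (E :: nat set set) (S :: nat set) (b :: nat) (w :: nat).
        split_graph {..<n} E \<longrightarrow> S \<subseteq> {..<n} \<longrightarrow>
        real k * log 2 (real (n + b + 2)) \<le> real w \<longrightarrow>
        decides_within w P (encode_instance n E S b) (T n)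
          (vertex_cover_discovery {..<n} E S b))"
proof (intro exI conjI allI impI)
  show "(\<lambda>n. real (cost (Suc n) discovery_program)) \<in> O(\<lambda>n. real n ^ 4)"
    by (rule cost_bigo[OF loop_depth_discovery_program])
  fix n :: nat and E S b w
  assume "split_graph {..<n} E" "S \<subseteq> {..<n}" and w: "real 8 * log 2 (real (n + b + 2)) \<le> real w"
  interpret machine w "Suc n" b by unfold_locales (rule word_length_suffices[OF w])
  show "decides_within w discovery_program (encode_instance n E S b) (cost (Suc n) discovery_program)
    (vertex_cover_discovery {..<n} E S b)"
    by (rule wp_decides[OF wp_discovery_program]) (rule \<open>split_graph {..<n} E\<close>, rule \<open>S \<subseteq> {..<n}\<close>, rule refl)
qed

end
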